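(* Let $K:\mathbb{R}_+^3\to[0,\infty)$ be measurable with $K(x,y,z)=K(y,x,z)$ for all $x,y,z$ and $K(x,y,z)=0$ whenever $z>x$. Let $\mu\in(1,2]$, $\varphi\in Y_{0,2}^+$, $\varphi_1\in Y_{0,1+\mu}^+$, and assume that for all $x,y,z\ge0$ $$\varphi_1(z)\bigl(\check x^2\check y^{\mu}+\check x^{\mu}\check y^2\bigr)\mathbf 1_{(z,\infty)^2}(x,y)\le K(x,y,z)\le\check x^2\check y^2\varphi(z),$$ and that for $x\ge0$ (and $y,z\ge0$) the second derivative of $K$ in its first variable satisfies $\partial_1^2K(\cdot,y,z)(x)\le\check y^2\varphi(z)$. Let $0\not\equiv c_0\in Y_{0,1+\mu}^+$ satisfy $M_2(\varphi_1)M_\mu(c_0)>M_{1+\mu}(\varphi_1)M_1(c_0)$. Let $c$ be a weak solution of (CGEDG) on $[0,T_0)$ with initial datum $c_0$ constructed as described in the context, $T_0=\bigl(2\|\varphi\|_{0,2}(M_0(c_0)+M_2(c_0))\bigr)^{-1}$. Then for $t\in[0,T_0)$ $$M_\mu(c_t)\ge\left(\frac{1}{M_\mu(c_0)-\frac{M_{1+\mu}(\varphi_1)}{M_2(\varphi_1)}M_1(c_0)}-\mu(\mu-1)2^{\mu-2}M_2(\varphi_1)\,t\right)^{-1}+\frac{M_{1+\mu}(\varphi_1)}{M_2(\varphi_1)}M_1(c_0).$$ Moreover, the gelation time of $c$ is finite and satisfies $$T_{gel}\le\left(\mu(\mu-1)2^{\mu-2}M_2(\varphi_1)\Bigl(M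_\mu(c_0)-\frac{M_{1+\mu}(\varphi_1)}{M_2(\varphi_1)}M_1(c_0)\Bigr)\right)^{-1}.$$
   Context: Notation: $\mathbb{R}_+=[0,\infty)$, $\check x=\max(1,x)$, $M_r(c)=\int_0^\infty x^rc(x)\,dx$. For $\beta,r\in\mathbb{R}$, $Y_{-\beta,r}=\{c\in L^1(\mathbb{R}_+):\|c\|_{-\beta,r}:=\int_0^\infty(x^{-\beta}+x^r)|c(x)|\,dx<\infty\}$, and $Y_{-\beta,r}^+$ is its cone of nonnegative elements. $Y_0=L^1(\mathbb{R}_+)$. Weak solution of the continuous generalized exchange-driven growth equation (CGEDG) with kernel $K$, here with parameters $(\beta,r)=(0,2)$: a map $c:[0,T)\to Y_{0,2}^+$, $t\mapsto c_t$, such that, with $\kappa[c_s](x,y,z):=K(x,y,z)c_s(x)c_s(y)$: (a) $c\in C([0,T),Y_0)\cap L^\infty([0,T),Y_{0,2})$; (b) for all $t\in[0,T)$, $\int_0^t\int_0^\infty\int_0^\infty\int_0^\infty\kappa[c_s](x,y,z)\,dx\,dy\,dz\,ds<\infty$; (c) for all $t\in[0,T)$ and all $f\in L^\infty(\mathbb{R}_+)$, $\int_0^\infty f(x)[c_t(x)-c_0(x)]\,dx=\int_0^t\iiint_D(\Delta_zf)(x)\,\kappa[c_s](x,y,z)\,dz\,dx\,dy\,ds$, where $D=\{(x,y,z)\in\mathbb{R}_+^3:x\ge z,\ y\ge z\}$ and $(\Delta_zf)(x)=f(x+z)-2f(x)+f(x-z)$. Gelation time of a weak solution: $T_{gel}:=\sup\{t\ge0:M_2(c_t)<\infty\}$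 (over the times $t$ at which the solution is defined). Constructed solution: for integers $n\ge2$ put $K_n(x,y,z)=K(x,y,z)\mathbf 1_{(1/n,n)^3}(x,y,z)\mathbf 1_{(0,n)^2}(x+z,y+z)\mathbf 1_{(1/n,\infty)^2}(x-z,y-z)$ and $c^n_0=c_0\mathbf 1_{(1/n,n)}$, and let $c^n\in C^1([0,\infty),L^1((1/n,n)))$, extended by $0$ outside $(1/n,n)$, be the unique nonnegative solution with initial datum $c_0^n$ of $$\partial_tc^n_t(x)=\iint\kappa_n(y,x-z,z)\,dz\,dy-\iint\kappa_n(x,y,z)\,dz\,dy-\iint\kappa_n(y,x,z)\,dz\,dy+\iint\kappa_n(x+z,y,z)\,dz\,dy,$$ where $\kappa_n(x,y,z)=K_n(x,y,z)c^n_t(x)c^n_t(y)$. The constructed weak solution $c$ on $[0,T_0)$ is one obtained as a limit of $(c^n)$ along a subsequence $(n_k)$ in $C([0,T],w\text{-}Y_{0,2})$ for every $T<T_0$, i.e. $\int_0^\infty g(x)(1+x^2)c^{n_k}_t(x)\,dx\to\int_0^\infty g(x)(1+x^2)c_t(x)\,dx$ uniformly in $t\in[0,T]$ for every $g\in L^\infty(\mathbb{R}_+)$; it preserves the mass $M_0$ and the first moment $M_1$ on $[0,T_0)$.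
   Formalization: The second derivative of K in its first variable is required to exist and satisfy the bound only at x ≠ z (one-sided at x = 0): for φ_1(z) > 0 and y > z the other hypotheses force K(·,y,z) to jump at x = z, so requiring it for every x ≥ 0 would be contradictory. *)

theory Defs
  imports "HOL-Analysis.Analysis"
begin

text \<open>
  Elements of $L^1$ and $L^\infty$ on the half-line are represented by (Borel) functions
  \<open>real \<Rightarrow> real\<close> of which only the values on \<open>{0..}\<close> matter; the spaces,
  norms, moments and weak solutions below do not depend on the choice of representatives. The convention \<open>0 powr r = 0\<close> concerns the null set \<open>{0}\<close> only.
\<close>

definition moment :: "real \<Rightarrow> (real \<Rightarrow> real) \<Rightarrow> real" where
  "moment r c = (LBINT x:{0..}. x powr r * c x)"

text \<open>\<open>Y \<beta> r\<close> is the space $Y_{-\beta,r}$ (note the sign), \<open>Y_norm \<beta> r\<close> its norm, and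
  \<open>Y_pos \<beta> r\<close> its cone of (almost everywhere) nonnegative elements.\<close>

definition Y :: "real \<Rightarrow> real \<Rightarrow> (real \<Rightarrow> real) set" where
  "Y \<beta> r = {c. set_integrable lborel {0..} c \<and>
               set_integrable lborel {0..} (\<lambda>x. (x powr (-\<beta>) + x powr r) * \<bar>c x\<bar>)}"

definition Y_norm :: "real \<Rightarrow> real \<Rightarrow> (real \<Rightarrow> real) \<Rightarrow> real" where
  "Y_norm \<beta> r c = (LBINT x:{0..}. (x powr (-\<beta>) + x powr r) * \<bar>c x\<bar>)"

definition Y_pos :: "real \<Rightarrow> real \<Rightarrow> (real \<Rightarrow> real) set" where
  "Y_pos \<beta> r = {c \<in> Y \<beta> r. AE x\<in>{0..} in lborel. 0 \<le> c x}"

definition L_infty :: "(real \<Rightarrow> real) set" where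
  "L_infty = {f. set_borel_measurable lborel {0..} f \<and>
                 (\<exists>C. AE x\<in>{0..} in lborel. \<bar>f x\<bar> \<le> C)}"

definition L1_dist :: "(real \<Rightarrow> real) \<Rightarrow> (real \<Rightarrow> real) \<Rightarrow> real" where
  "L1_dist u v = (LBINT x:{0..}. \<bar>u x - v x\<bar>)"

abbreviation octant :: "(real \<times> real \<times> real) set" where
  "octant \<equiv> {0..} \<times> {0..} \<times> {0..}"

type_synonym kernel = "real \<Rightarrow> real \<Rightarrow> real \<Rightarrow> real"

definition kappa :: "kernel \<Rightarrow> (real \<Rightarrow> real) \<Rightarrow> kernel" where
  "kappa K c x y z = K x y z * c x * c y"

definition exchange_domain :: "(real \<times> real \<times> real) set" where
  "exchange_domain = {(x, y, z). (x, y, z) \<in> octant \<and> z \<le> x \<and> z \<le> y}"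

definition second_diff :: "real \<Rightarrow> (real \<Rightarrow> real) \<Rightarrow> real \<Rightarrow> real" where
  "second_diff z f x = f (x + z) - 2 * f x + f (x - z)"

text \<open>
  Weak solutions on \<open>{0..<T}\<close> for the parameters $(\beta,r)=(0,2)$. The time integrals are
  taken outside the spatial ones, so that no joint measurability of the chosen representatives
  \<open>(s, x) \<mapsto> c s x\<close> is presupposed.
\<close>

definition weak_solution :: "kernel \<Rightarrow> real \<Rightarrow> (real \<Rightarrow> real \<Rightarrow> real) \<Rightarrow> bool" where
  "weak_solution K T c \<longleftrightarrow>
     (\<forall>t\<in>{0..<T}. c t \<in> Y_pos 0 2) \<and>
     (\<forall>t\<in>{0..<T}. ((\<lambda>s. L1_dist (c s) (c t)) \<longlongrightarrow> 0) (at t within {0..<T})) \<and>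
     (\<exists>C. AE t\<in>{0..<T} in lborel. Y_norm 0 2 (c t) \<le> C) \<and>
     (\<forall>t\<in>{0..<T}.
        (\<integral>\<^sup>+s\<in>{0..t}. (\<integral>\<^sup>+p\<in>octant. (case p of (x, y, z) \<Rightarrow> ennreal (kappa K (c s) x y z))
           \<partial>lborel) \<partial>lborel) < \<infinity>) \<and>
     (\<forall>t\<in>{0..<T}. \<forall>f\<in>L_infty.
        (LBINT x:{0..}. f x * (c t x - c 0 x)) =
        (LBINT s:{0..t}. (LBINT p:exchange_domain.
           (case p of (x, y, z) \<Rightarrow> second_diff z f x * kappa K (c s) x y z))))"

definition gelation_time :: "real \<Rightarrow> (real \<Rightarrow> real \<Rightarrow> real) \<Rightarrow> ereal" where
  "gelation_time T c =
     (SUP t\<in>{t\<in>{0..<T}. (\<integral>\<^sup>+x\<in>{0..}. ennreal (x powr 2 * c t x) \<partial>lborel) < \<infinity>}. ereal t)"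

definition trunc_kernel :: "kernel \<Rightarrow> nat \<Rightarrow> kernel" where
  "trunc_kernel K n x y z =
     K x y z
     * indicator ({1 / real n<..<real n} \<times> {1 / real n<..<real n} \<times> {1 / real n<..<real n}) (x, y, z)
     * indicator ({0<..<real n} \<times> {0<..<real n}) (x + z, y + z)
     * indicator ({1 / real n<..} \<times> {1 / real n<..}) (x - z, y - z)"

definition trunc_rhs :: "kernel \<Rightarrow> nat \<Rightarrow> (real \<Rightarrow> real) \<Rightarrow> real \<Rightarrow> real" where
  "trunc_rhs K n u x =
     (let k = kappa (trunc_kernel K n) u in
        (LBINT p:{0..}\<times>{0..}. (case p of (z, y) \<Rightarrow> k y (x - z) z))
      - (LBINT p:{0..}\<times>{0..}. (case p of (z, y) \<Rightarrow> k x y z))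
      - (LBINT p:{0..}\<times>{0..}. (case p of (z, y) \<Rightarrow> k y x z))
      + (LBINT p:{0..}\<times>{0..}. (case p of (z, y) \<Rightarrow> k (x + z) y z)))"

text \<open>
  \<open>u\<close> is a nonnegative solution, continuously differentiable from \<open>{0..}\<close> into $L^1$ of the
  interval $(1/n,n)$, of the truncated equation; the time derivative is the limit of
  difference quotients in $L^1$, and equals the right-hand side of the equation.
\<close>

definition truncated_solution ::
  "kernel \<Rightarrow> (real \<Rightarrow> real) \<Rightarrow> nat \<Rightarrow> (real \<Rightarrow> real \<Rightarrow> real) \<Rightarrow> bool" where
  "truncated_solution K c0 n u \<longleftrightarrow>
     (\<forall>t\<ge>0. set_integrable lborel {1 / real n<..<real n} (u t) \<and>
            (\<forall>x. x \<notin> {1 / real n<..<real n} \<longrightarrow> u t x = 0) \<and>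
            (AE x in lborel. 0 \<le> u t x)) \<and>
     (AE x in lborel. u 0 x = c0 x * indicator {1 / real n<..<real n} x) \<and>
     (\<forall>t\<ge>0. set_integrable lborel {1 / real n<..<real n} (trunc_rhs K n (u t)) \<and>
            ((\<lambda>s. L1_dist (\<lambda>x. (u s x - u t x) / (s - t)) (trunc_rhs K n (u t))) \<longlongrightarrow> 0)
              (at t within {0..}) \<and>
            ((\<lambda>s. L1_dist (trunc_rhs K n (u s)) (trunc_rhs K n (u t))) \<longlongrightarrow> 0)
              (at t within {0..}))"

text \<open>
  Weak solutions obtained as subsequential limits, in $C([0,S],w\text{-}Y_{0,2})$ for every
  \<open>S < T\<close>, of the truncated solutions. The latter are unique up to null sets, so that the
  existentially quantified family \<open>cn\<close> is determined by \<open>K\<close> and \<open>c0\<close>.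
  Preservation of the moments of order 0 and 1 is not part of the definition.
\<close>

definition constructed_solution ::
  "kernel \<Rightarrow> (real \<Rightarrow> real) \<Rightarrow> real \<Rightarrow> (real \<Rightarrow> real \<Rightarrow> real) \<Rightarrow> bool" where
  "constructed_solution K c0 T c \<longleftrightarrow>
     weak_solution K T c \<and>
     (AE x\<in>{0..} in lborel. c 0 x = c0 x) \<and>
     (\<exists>cn \<nu>. (\<forall>n\<ge>2. truncated_solution K c0 n (cn n)) \<and>
        strict_mono \<nu> \<and> (\<forall>k. 2 \<le> \<nu> k) \<and>
        (\<forall>S\<in>{0..<T}. \<forall>g\<in>L_infty.
           uniform_limit {0..S}
             (\<lambda>k t. LBINT x:{0..}. g x * (1 + x\<^sup>2) * cn (\<nu> k) t x)
             (\<lambda>t. LBINT x:{0..}. g x * (1 + x\<^sup>2) * c t x)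
             sequentially))"

end

(* Testing the truncated equation with x^mu gives, by convexity of the power and the lower bound on
   the kernel, a growth rate bounded below by a multiple of the integral of z^2 phi1(z) U(z)^2, where
   U(z) is the part of the mu-th moment carried by x > z. The tangent bound U^2 >= 2 l U - l^2 makes
   this linear in the solution, so that only integrals of the solution against functions of growth at
   most x^2 occur; these pass to the limit uniformly in time, and neither tightness of higher moments
   nor the weak formulation is involved. Since x^mu M_2(phi1) - x M_{1+mu}(phi1) is a lower bound for
   the resulting test function and the first moment is conserved,
   m(t) = M_mu(c_t) - M_{1+mu}(phi1) / M_2(phi1) M_1(c_0) satisfies a discrete form of m' >= k m^2,
   hence 1 / m(t) <= 1 / m(0) - k t. As 1 / m(t) > 0, this also bounds the lifetime. *)

theory Submission
  imports Defs
begin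

text \<open>Optimised over l, the tangent bound is the Cauchy-Schwarz inequality for the measure z^2
  phi1(z) dz of mass M_2(phi1), so fixing l beforehand costs nothing if l is chosen well. On a time
  interval [s,t] the choice is l = m(s): M_mu is nondecreasing, hence the linear functional stays
  above M_2(phi1) m(s) on the whole interval, and 2 l M_2(phi1) m(s) - l^2 M_2(phi1) = M_2(phi1)
  m(s)^2. Freezing m at s is repaired by refining the partition. The square arises because the
  second difference of x^mu contributes z^2 x^(mu-2), and the summand phi1(z) x^2 y^mu of the kernel
  bound completes this to z^2 phi1(z) x^mu y^mu. There are two levels of truncation. The cut-offs of
  K_n at the edge of (1/n,n) would spoil a lower bound; a second cut at level N keeps the exchanges
  away from that edge for all n >= 2N. The bound then has a form independent of n, so that n tends
  to infinity before N does.\<close>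

section \<open>Convexity of the power, discrete comparison and a one-sided Dini theorem\<close>

text \<open>For 0 <= s <= z both x - s and x + s lie in (0, 2x], where t^(mu-2) is nonincreasing
  because mu <= 2; its value at 2x bounds both terms of the second derivative, which is the source
  of 2^(mu-2). Since \<open>h'\<close> vanishes at 0, two integrations make \<open>h\<close>, the
  even part minus the target quadratic, nondecreasing.\<close>

lemma second_diff_powr_ge:
  fixes \<mu> x z :: real
  assumes "1 < \<mu>" "\<mu> \<le> 2" "0 \<le> z" "z < x"
  shows "\<mu> * (\<mu> - 1) * 2 powr (\<mu> - 2) * (z\<^sup>2 * x powr (\<mu> - 2)) \<le> second_diff z (\<lambda>x. x powr \<mu>) x"
proof -
  define \<kappa> where "\<kappa> = \<mu> * (\<mu> - 1) * (2 * x) powr (\<mu> - 2)"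
  define h where "h = (\<lambda>z. (x + z) powr \<mu> + (x - z) powr \<mu> - \<kappa> * z\<^sup>2)"
  define h' where "h' = (\<lambda>z. \<mu> * ((x + z) powr (\<mu> - 1) - (x - z) powr (\<mu> - 1)) - 2 * \<kappa> * z)"
  define h'' where "h'' = (\<lambda>z. \<mu> * (\<mu> - 1) * ((x + z) powr (\<mu> - 2) + (x - z) powr (\<mu> - 2)) - 2 * \<kappa>)"
  have d1: "(h has_real_derivative h' s) (at s)" if "0 \<le> s" "s \<le> z" for s
    unfolding h_def h'_def using that assms
    by (auto intro!: derivative_eq_intros simp: powr_diff algebra_simps)
  have d2: "(h' has_real_derivative h'' s) (at s)" if "0 \<le> s" "s \<le> z" for s
    unfolding h'_def h''_def using that assms
    by (auto intro!: derivative_eq_intros simp: algebra_simps)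
  have "h'' s \<ge> 0" if "0 \<le> s" "s \<le> z" for s
  proof -
    have "(2 * x) powr (\<mu> - 2) \<le> (x + s) powr (\<mu> - 2)" "(2 * x) powr (\<mu> - 2) \<le> (x - s) powr (\<mu> - 2)"
      using that assms by (auto intro!: powr_mono2')
    then have "\<mu> * (\<mu> - 1) * (2 * (2 * x) powr (\<mu> - 2))
        \<le> \<mu> * (\<mu> - 1) * ((x + s) powr (\<mu> - 2) + (x - s) powr (\<mu> - 2))"
      using assms by (intro mult_left_mono) auto
    then show ?thesis by (simp add: h''_def \<kappa>_def algebra_simps)
  qed
  then have "h' 0 \<le> h' s" if "0 \<le> s" "s \<le> z" for s
    using that d2 by (intro DERIV_nonneg_imp_nondecreasing[of 0 s h']) force+
  then have "h' s \<ge> 0" if "0 \<le> s" "s \<le> z" for s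
    using that by (force simp: h'_def)
  then have "h 0 \<le> h z"
    using d1 assms by (intro DERIV_nonneg_imp_nondecreasing[of 0 z h]) force+
  then show ?thesis
    using assms by (simp add: h_def \<kappa>_def second_diff_def powr_mult algebra_simps)
qed

text \<open>Over a partition of \<open>{0..t}\<close> into \<open>n\<close> equal pieces, \<open>m s / m s' \<ge> 1 - ln (m s' / m s)\<close>
  telescopes and loses only \<open>O(1/n)\<close>; continuity of \<open>m\<close> is not involved.\<close>

lemma discrete_riccati:
  fixes m :: "real \<Rightarrow> real"
  assumes pos: "\<And>s. 0 \<le> s \<Longrightarrow> s \<le> t \<Longrightarrow> 0 < m s"
    and step: "\<And>r s. 0 \<le> r \<Longrightarrow> r \<le> s \<Longrightarrow> s \<le> t \<Longrightarrow> \<kappa> * (s - r) * (m r)\<^sup>2 \<le> m s - m r"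
    and "0 \<le> t" "0 \<le> \<kappa>"
  shows "\<kappa> * t \<le> inverse (m 0) - inverse (m t)"
proof -
  have one: "\<kappa> * (s - r) * (1 - (ln (m s) - ln (m r))) \<le> inverse (m r) - inverse (m s)"
    if "0 \<le> r" "r \<le> s" "s \<le> t" for r s
  proof -
    have p: "0 < m r" "0 < m s" using pos that by auto
    have "1 - (ln (m s) - ln (m r)) \<le> m r / m s"
      using ln_le_minus_one[of "m r / m s"] p by (simp add: ln_div)
    then have "\<kappa> * (s - r) * (1 - (ln (m s) - ln (m r))) \<le> \<kappa> * (s - r) * (m r / m s)"
      using that assms by (intro mult_left_mono) auto
    also have "\<dots> = (\<kappa> * (s - r) * (m r)\<^sup>2) / (m r * m s)"
      using p by (simp add: power2_eq_square)
    also have "\<dots> \<le> (m s - m r) / (m r * m s)"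
      using step[OF that] p by (intro divide_right_mono) auto
    also have "\<dots> = inverse (m r) - inverse (m s)"
      using p by (simp add: field_simps)
    finally show ?thesis .
  qed
  have "\<kappa> * t - (\<kappa> * t * (ln (m t) - ln (m 0))) / real (Suc n) \<le> inverse (m 0) - inverse (m t)" for n
  proof -
    define N where "N = Suc n"
    define p where "p = (\<lambda>i. real i * t / real N)"
    have N: "N > 0" by (simp add: N_def)
    have p: "0 \<le> p i" "p i \<le> p (Suc i)" for i
      using assms N by (auto simp: p_def divide_right_mono mult_right_mono)
    have pt: "p i \<le> t" if "i \<le> N" for i
      using mult_right_mono[of "real i" "real N" t] that assms N by (simp add: p_def divide_le_eq mult.commute)
    have "(\<Sum>i<N. \<kappa> * (p (Suc i) - p i) * (1 - (ln (m (p (Suc i))) - ln (m (p i)))))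
        \<le> (\<Sum>i<N. inverse (m (p i)) - inverse (m (p (Suc i))))"
      using p pt by (intro sum_mono one) auto
    also have "\<dots> = inverse (m 0) - inverse (m t)"
      using N by (subst sum_lessThan_telescope') (auto simp: p_def)
    also have "(\<Sum>i<N. \<kappa> * (p (Suc i) - p i) * (1 - (ln (m (p (Suc i))) - ln (m (p i)))))
        = \<kappa> * t / N * (N - (\<Sum>i<N. ln (m (p (Suc i))) - ln (m (p i))))"
    proof -
      have "p (Suc i) - p i = t / N" for i by (simp add: p_def distrib_left distrib_right add_divide_distrib)
      then show ?thesis
        by (simp only: times_divide_eq_right right_diff_distrib sum_subtractf sum_distrib_left) simp
    qed
    also have "(\<Sum>i<N. ln (m (p (Suc i))) - ln (m (p i))) = ln (m t) - ln (m 0)"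
      using N by (subst sum_lessThan_telescope) (auto simp: p_def)
    finally show ?thesis using N by (simp add: N_def[symmetric] field_simps)
  qed
  moreover have "(\<lambda>n. \<kappa> * t - (\<kappa> * t * (ln (m t) - ln (m 0))) / real (Suc n)) \<longlonglongrightarrow> \<kappa> * t - 0"
    by (intro tendsto_intros LIMSEQ_Suc lim_const_over_n)
  ultimately show ?thesis by (intro LIMSEQ_le_const2[where X="\<lambda>n. \<kappa> * t - (\<kappa> * t * (ln (m t) - ln (m 0))) / real (Suc n)"]) auto
qed

text \<open>The sets of times with gap at least \<open>e\<close> are compact and decreasing in
  \<open>N\<close>; if none were empty, a common point would contradict pointwise convergence. It
  supplies a single cut-off level \<open>N\<close> valid for a whole time interval, which is needed
  because \<open>N\<close> has to be fixed before the truncated solutions converge.\<close>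

lemma dini_lower:
  fixes p :: "nat \<Rightarrow> real \<Rightarrow> real"
  assumes cont: "\<And>N. continuous_on {s..t} (p N)" and contq: "continuous_on {s..t} q"
    and mono: "\<And>N r. r \<in> {s..t} \<Longrightarrow> p N r \<le> p (Suc N) r"
    and lim: "\<And>r. r \<in> {s..t} \<Longrightarrow> (\<lambda>N. p N r) \<longlonglongrightarrow> q r"
    and "0 < e"
  shows "\<exists>N. \<forall>r\<in>{s..t}. q r - e < p N r"
proof (rule ccontr)
  assume neg: "\<not> ?thesis"
  define F where "F = (\<lambda>N. {r\<in>{s..t}. e \<le> q r - p N r})"
  have "compact (F N)" for N
  proof -
    have "F N = {s..t} \<inter> (\<lambda>r. q r - p N r) -` {e..}" by (auto simp: F_def)
    moreover have "continuous_on {s..t} (\<lambda>r. q r - p N r)"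
      by (intro continuous_on_diff cont contq)
    ultimately have "closed (F N)"
      using continuous_closed_preimage[of "{s..t}" "\<lambda>r. q r - p N r" "{e..}"] by simp
    moreover have "F N = {s..t} \<inter> F N" by (auto simp: F_def)
    ultimately show ?thesis by (metis compact_Icc compact_Int_closed)
  qed
  moreover have "F N \<noteq> {}" for N
  proof -
    obtain r where "r \<in> {s..t}" "\<not> q r - e < p N r" using neg by blast
    then have "r \<in> F N" by (auto simp: F_def)
    then show ?thesis by blast
  qed
  moreover have "F n \<subseteq> F k" if "k \<le> n" for k n
    using lift_Suc_mono_le[of "\<lambda>N. p N _", OF mono] that by (force simp: F_def)
  ultimately have "(\<Inter>N. F N) \<noteq> {}" by (rule compact_nest)
  then obtain r where r: "\<And>N. r \<in> F N" by blast
  then have "(\<lambda>N. q r - p N r) \<longlonglongrightarrow> q r - q r" by (intro tendsto_intros lim) (auto simp: F_def)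
  then have "e \<le> q r - q r" by (rule LIMSEQ_le_const) (use r in \<open>auto simp: F_def\<close>)
  then show False using \<open>0 < e\<close> by simp
qed

section \<open>Moving a displacement from the flux to the test function\<close>

text \<open>For fixed p the map is a translation in x, and Lebesgue measure is translation
  invariant. Tonelli applied to the norm gives integrability, after which Fubini applies to the
  signed integral.\<close>

lemma integrable_shear:
  fixes F :: "'a \<times> real \<Rightarrow> real" and s :: "'a \<Rightarrow> real"
  assumes P: "sigma_finite_measure P" and [measurable]: "s \<in> borel_measurable P"
    and F: "integrable (P \<Otimes>\<^sub>M lborel) F"
  shows "integrable (P \<Otimes>\<^sub>M lborel) (\<lambda>(p, x). F (p, x + s p))" (is "integrable _ ?G")
    and "(\<integral>w. (case w of (p, x) \<Rightarrow> F (p, x + s p)) \<partial>(P \<Otimes>\<^sub>M lborel)) = integral\<^sup>L (P \<Otimes>\<^sub>M lborel) F"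
proof -
  interpret pair_sigma_finite P "lborel :: real measure"
    unfolding pair_sigma_finite_def using P lborel.sigma_finite_measure_axioms by auto
  have [measurable]: "F \<in> borel_measurable (P \<Otimes>\<^sub>M lborel)"
    using F by auto
  have "(\<integral>\<^sup>+w. norm (?G w) \<partial>(P \<Otimes>\<^sub>M lborel)) = (\<integral>\<^sup>+p. \<integral>\<^sup>+x. norm (F (p, x + s p)) \<partial>lborel \<partial>P)"
    by (subst lborel.nn_integral_fst[symmetric]) auto
  also have "\<dots> = (\<integral>\<^sup>+p. \<integral>\<^sup>+x. norm (F (p, x)) \<partial>lborel \<partial>P)"
  proof (rule nn_integral_cong)
    fix p assume [measurable]: "p \<in> space P"
    show "(\<integral>\<^sup>+x. norm (F (p, x + s p)) \<partial>lborel) = (\<integral>\<^sup>+x. norm (F (p, x)) \<partial>lborel)"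
      using nn_integral_real_affine[of "\<lambda>x. ennreal (norm (F (p, x)))" 1 "s p"] by (simp add: add.commute)
  qed
  also have "\<dots> = (\<integral>\<^sup>+w. norm (F w) \<partial>(P \<Otimes>\<^sub>M lborel))"
    by (rule lborel.nn_integral_fst) auto
  also have "\<dots> < \<infinity>" using F by (simp add: integrable_iff_bounded)
  finally show G: "integrable (P \<Otimes>\<^sub>M lborel) ?G"
    by (simp add: integrable_iff_bounded)
  have "integral\<^sup>L (P \<Otimes>\<^sub>M lborel) ?G = (\<integral>p. \<integral>x. F (p, x + s p) \<partial>lborel \<partial>P)"
    using integral_fst'[OF G] by simp
  also have "\<dots> = (\<integral>p. \<integral>x. F (p, x) \<partial>lborel \<partial>P)"
  proof (rule Bochner_Integration.integral_cong[OF refl])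
    show "(\<integral>x. F (p, x + s p) \<partial>lborel) = (\<integral>x. F (p, x) \<partial>lborel)" for p
      using lborel_integral_real_affine[of 1 "\<lambda>x. F (p, x)" "s p"] by (simp add: add.commute)
  qed
  also have "\<dots> = integral\<^sup>L (P \<Otimes>\<^sub>M lborel) F"
    by (rule integral_fst'[OF F])
  finally show "integral\<^sup>L (P \<Otimes>\<^sub>M lborel) ?G = integral\<^sup>L (P \<Otimes>\<^sub>M lborel) F" .
qed

text \<open>Gain terms of the truncated equation are marginals of the flux read at a displaced
  argument. Shearing (p, x) -> f (x - s p) G (p, x) cancels the displacement in \<open>f\<close> and
  puts it on \<open>G\<close>.\<close>

lemma integral_against_sheared_marginal:
  fixes G :: "'a \<times> real \<Rightarrow> real" and s :: "'a \<Rightarrow> real"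
  assumes P: "sigma_finite_measure P" and s[measurable]: "s \<in> borel_measurable P"
    and G: "integrable (P \<Otimes>\<^sub>M lborel) G"
    and f[measurable]: "f \<in> borel_measurable borel" and bound: "\<And>x. \<bar>f x\<bar> \<le> C"
  shows "integrable lborel (\<lambda>x. f x * (\<integral>p. G (p, x + s p) \<partial>P))"
    and "integrable (P \<Otimes>\<^sub>M lborel) (\<lambda>(p, x). f (x - s p) * G (p, x))"
    and "(\<integral>x. f x * (\<integral>p. G (p, x + s p) \<partial>P) \<partial>lborel)
         = (\<integral>w. (case w of (p, x) \<Rightarrow> f (x - s p) * G (p, x)) \<partial>(P \<Otimes>\<^sub>M lborel))"
proof -
  interpret pair_sigma_finite P "lborel :: real measure"
    unfolding pair_sigma_finite_def using P lborel.sigma_finite_measure_axioms by auto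
  have [measurable]: "G \<in> borel_measurable (P \<Otimes>\<^sub>M lborel)" using G by auto
  show H: "integrable (P \<Otimes>\<^sub>M lborel) (\<lambda>(p, x). f (x - s p) * G (p, x))"
  proof (rule Bochner_Integration.integrable_bound)
    show "integrable (P \<Otimes>\<^sub>M lborel) (\<lambda>w. C * G w)" using G by simp
    show "(\<lambda>(p, x). f (x - s p) * G (p, x)) \<in> borel_measurable (P \<Otimes>\<^sub>M lborel)" by measurable
    have "\<bar>f y * g\<bar> \<le> \<bar>C * g\<bar>" for y g
      using bound[of y] by (simp add: abs_mult mult_right_mono)
    then show "AE w in P \<Otimes>\<^sub>M lborel. norm ((\<lambda>(p, x). f (x - s p) * G (p, x)) w) \<le> norm (C * G w)"
      by (auto simp: case_prod_beta)
  qed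
  have S: "integrable (P \<Otimes>\<^sub>M lborel) (\<lambda>(p, x). f x * G (p, x + s p))"
    using integrable_shear(1)[OF P s H] by simp
  have "(\<integral>w. (case w of (p, x) \<Rightarrow> f x * G (p, x + s p)) \<partial>(P \<Otimes>\<^sub>M lborel))
      = (\<integral>w. (case w of (p, x) \<Rightarrow> f (x - s p) * G (p, x)) \<partial>(P \<Otimes>\<^sub>M lborel))"
    using integrable_shear(2)[OF P s H] by simp
  moreover have "(\<integral>w. (case w of (p, x) \<Rightarrow> f x * G (p, x + s p)) \<partial>(P \<Otimes>\<^sub>M lborel))
      = (\<integral>x. f x * (\<integral>p. G (p, x + s p) \<partial>P) \<partial>lborel)"
    using integral_snd[OF S] by simp
  ultimately show "(\<integral>x. f x * (\<integral>p. G (p, x + s p) \<partial>P) \<partial>lborel)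
         = (\<integral>w. (case w of (p, x) \<Rightarrow> f (x - s p) * G (p, x)) \<partial>(P \<Otimes>\<^sub>M lborel))" by simp
  show "integrable lborel (\<lambda>x. f x * (\<integral>p. G (p, x + s p) \<partial>P))"
    using integrable_snd[OF S] by simp
qed

lemma integrable_tensor:
  fixes f :: "'a \<Rightarrow> real" and g :: "'b \<Rightarrow> real"
  assumes "sigma_finite_measure M1" "sigma_finite_measure M2"
    and f: "integrable M1 f" and g: "integrable M2 g"
  shows "integrable (M1 \<Otimes>\<^sub>M M2) (\<lambda>(x, y). f x * g y)"
proof -
  interpret pair_sigma_finite M1 M2
    unfolding pair_sigma_finite_def using assms by auto
  have [measurable]: "f \<in> borel_measurable M1" "g \<in> borel_measurable M2" using f g by auto
  show ?thesis
    using f g by (intro Fubini_integrable) (auto simp: abs_mult)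
qed

lemma integral_second_diff:
  fixes a b c :: "'a \<Rightarrow> real"
  assumes "integrable M a" "integrable M b" "integrable M c"
  shows "(\<integral>x. a x - 2 * b x + c x \<partial>M) = (\<integral>x. a x \<partial>M) - 2 * (\<integral>x. b x \<partial>M) + (\<integral>x. c x \<partial>M)"
  using assms by simp

lemma sigma_finite_lborel_pair: "sigma_finite_measure (lborel \<Otimes>\<^sub>M (lborel :: real measure) :: (real \<times> real) measure)"
  unfolding lborel_prod by (rule lborel.sigma_finite_measure_axioms)

abbreviation zy_measure :: "(real \<times> real) measure" where
  "zy_measure \<equiv> lborel \<Otimes>\<^sub>M lborel"

section \<open>The truncated equation and its weak form\<close>

text \<open>On the support of the truncated kernel x - z, x and x + z all lie in the window (1/n,
  n). Hence cutting a test function off at the window does not change its second difference there.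
  The case n = 0 is excluded because 1 / 0 = 0 leaves an empty window.\<close>

lemma trunc_kernel_nonzeroD:
  assumes "trunc_kernel K n x y z \<noteq> 0"
  shows "1 / real n < x" "x < real n" "1 / real n < y" "y < real n" "1 / real n < z" "z < real n"
    "x + z < real n" "y + z < real n" "1 / real n < x - z" "1 / real n < y - z"
    "0 < x" "0 < y" "0 < z" "0 < n" "z < x" "z < y"
proof -
  show *: "1 / real n < x" "x < real n" "1 / real n < y" "y < real n" "1 / real n < z" "z < real n"
    "x + z < real n" "y + z < real n" "1 / real n < x - z" "1 / real n < y - z"
    using assms by (auto simp: trunc_kernel_def indicator_def split: if_splits)
  have "0 \<le> 1 / real n" by simp
  then show "0 < x" "0 < y" "0 < z" "z < x" "z < y" using * by linarith+
  then show "0 < n" using * by (cases n) auto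
qed

locale exchange_kernel =
  fixes K :: kernel and \<phi> :: "real \<Rightarrow> real"
  assumes K_meas: "set_borel_measurable borel octant (\<lambda>(x, y, z). K x y z)"
    and K_nonneg: "\<And>x y z. x \<ge> 0 \<Longrightarrow> y \<ge> 0 \<Longrightarrow> z \<ge> 0 \<Longrightarrow> 0 \<le> K x y z"
    and K_sym: "\<And>x y z. x \<ge> 0 \<Longrightarrow> y \<ge> 0 \<Longrightarrow> z \<ge> 0 \<Longrightarrow> K x y z = K y x z"
    and K_upper: "\<And>x y z. x \<ge> 0 \<Longrightarrow> y \<ge> 0 \<Longrightarrow> z \<ge> 0 \<Longrightarrow>
        K x y z \<le> (max 1 x)\<^sup>2 * (max 1 y)\<^sup>2 * \<phi> z"
    and \<phi>_integrable: "set_integrable lborel {0..} \<phi>"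
begin

text \<open>The displaced variable x comes last, so that the shear lemmas apply with the pair (z, y)
  as parameter; (z, y) is the order of integration in \<open>trunc_rhs\<close>.\<close>

definition flux :: "nat \<Rightarrow> (real \<Rightarrow> real) \<Rightarrow> (real \<times> real) \<times> real \<Rightarrow> real" where
  "flux n u = (\<lambda>((z, y), x). kappa (trunc_kernel K n) u x y z)"

lemma trunc_kernel_sym: "trunc_kernel K n x y z = trunc_kernel K n y x z"
proof (cases "0 \<le> x \<and> 0 \<le> y \<and> 0 \<le> z")
  case True
  then show ?thesis using K_sym[of x y z] by (auto simp: trunc_kernel_def indicator_def)
next
  case False
  then have "trunc_kernel K n x y z = 0" "trunc_kernel K n y x z = 0"
    using trunc_kernel_nonzeroD(11-13)[of K n x y z] trunc_kernel_nonzeroD(11-13)[of K n y x z]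
    by (meson less_imp_le)+
  then show ?thesis by simp
qed

text \<open>In the window each of the two squared factors of the upper bound is at most n^2. What
  remains depends on z alone and is integrable, so the flux is dominated by a tensor
  product.\<close>

lemma trunc_kernel_bounds:
  "0 \<le> trunc_kernel K n x y z"
  "trunc_kernel K n x y z \<le> real n ^ 4 * (indicator {0..} z * \<phi> z)"
proof -
  \<comment> \<open>Nonnegativity of \<phi> at every z >= 0, not just almost everywhere, is forced
    by 0 <= K 1 1 z <= \<phi> z.\<close>
  have \<phi>: "0 \<le> indicator {0..} z * \<phi> z"
    using K_nonneg[of 1 1 z] K_upper[of 1 1 z] by (auto simp: indicator_def)
  show "0 \<le> trunc_kernel K n x y z"
  proof (cases "trunc_kernel K n x y z = 0")
    case False
    then have "0 \<le> K x y z" using trunc_kernel_nonzeroD[OF False] by (intro K_nonneg) auto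
    then show ?thesis by (auto simp: trunc_kernel_def)
  qed simp
  show "trunc_kernel K n x y z \<le> real n ^ 4 * (indicator {0..} z * \<phi> z)"
  proof (cases "trunc_kernel K n x y z = 0")
    case True
    then show ?thesis using \<phi> by simp
  next
    case False
    note nz = trunc_kernel_nonzeroD[OF False]
    have "trunc_kernel K n x y z = K x y z" using False by (auto simp: trunc_kernel_def indicator_def)
    also have "\<dots> \<le> (max 1 x)\<^sup>2 * (max 1 y)\<^sup>2 * \<phi> z" using nz by (intro K_upper) auto
    also have "\<dots> \<le> (real n)\<^sup>2 * (real n)\<^sup>2 * \<phi> z"
      using nz \<phi> by (intro mult_right_mono mult_mono power_mono) auto
    also have "\<dots> = real n ^ 4 * (indicator {0..} z * \<phi> z)"
      using nz by (simp add: power4_eq_xxxx power2_eq_square)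
    finally show ?thesis .
  qed
qed

lemma trunc_kernel_measurable [measurable]:
  "(\<lambda>((z, y), x). trunc_kernel K n x y z) \<in> borel_measurable (zy_measure \<Otimes>\<^sub>M lborel)"
proof -
  \<comment> \<open>K is known to be measurable on the octant only. Its extension by zero gives the
    same truncated kernel, because the cut-offs vanish off the octant.\<close>
  define Kb where "Kb = (\<lambda>p. indicator octant p *\<^sub>R (case p of (x, y, z) \<Rightarrow> K x y z))"
  have [measurable]: "Kb \<in> borel_measurable (borel \<Otimes>\<^sub>M borel \<Otimes>\<^sub>M borel)"
    using K_meas by (simp add: Kb_def set_borel_measurable_def borel_prod)
  have "trunc_kernel K n x y z = Kb (x, y, z)
     * (indicator {1 / real n<..<real n} x * indicator {1 / real n<..<real n} y * indicator {1 / real n<..<real n} z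
     * indicator {0<..<real n} (x + z) * indicator {0<..<real n} (y + z)
     * indicator {1 / real n<..} (x - z) * indicator {1 / real n<..} (y - z))" for x y z
  proof (cases "x \<ge> 0 \<and> y \<ge> 0 \<and> z \<ge> 0")
    case True
    then show ?thesis by (auto simp: trunc_kernel_def Kb_def indicator_def)
  next
    case False
    then have "trunc_kernel K n x y z = 0" using trunc_kernel_nonzeroD(11-13)[of K n x y z] by (meson less_imp_le)
    moreover have "Kb (x, y, z) = 0" using False by (auto simp: Kb_def)
    ultimately show ?thesis by simp
  qed
  then have "(\<lambda>((z, y), x). trunc_kernel K n x y z) = (\<lambda>((z, y), x). Kb (x, y, z)
     * (indicator {1 / real n<..<real n} x * indicator {1 / real n<..<real n} y * indicator {1 / real n<..<real n} z
     * indicator {0<..<real n} (x + z) * indicator {0<..<real n} (y + z)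
     * indicator {1 / real n<..} (x - z) * indicator {1 / real n<..} (y - z)))"
    by presburger
  also have "\<dots> \<in> borel_measurable (zy_measure \<Otimes>\<^sub>M lborel)"
    unfolding case_prod_beta by measurable
  finally show ?thesis .
qed

lemma flux_integrable:
  assumes u: "integrable lborel u"
  shows "integrable (zy_measure \<Otimes>\<^sub>M lborel) (flux n u)"
proof (rule Bochner_Integration.integrable_bound)
  have [measurable]: "u \<in> borel_measurable borel" using u by auto
  have "integrable lborel (\<lambda>z. real n ^ 4 * (indicator {0..} z * \<phi> z))"
    using \<phi>_integrable by (simp add: set_integrable_def)
  then have "integrable zy_measure (\<lambda>(z, y). (real n ^ 4 * (indicator {0..} z * \<phi> z)) * u y)"
    using u by (rule integrable_tensor[OF lborel.sigma_finite_measure_axioms lborel.sigma_finite_measure_axioms])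
  then show "integrable (zy_measure \<Otimes>\<^sub>M lborel)
      (\<lambda>(p, x). (case p of (z, y) \<Rightarrow> (real n ^ 4 * (indicator {0..} z * \<phi> z)) * u y) * u x)"
    using u by (rule integrable_tensor[OF sigma_finite_lborel_pair lborel.sigma_finite_measure_axioms])
  show "flux n u \<in> borel_measurable (zy_measure \<Otimes>\<^sub>M lborel)"
    using trunc_kernel_measurable[of n] unfolding flux_def kappa_def case_prod_beta by measurable
  have "\<bar>trunc_kernel K n x y z * u x * u y\<bar> \<le> \<bar>(real n ^ 4 * (indicator {0..} z * \<phi> z)) * u y * u x\<bar>" for x y z
  proof -
    have "\<bar>trunc_kernel K n x y z\<bar> \<le> \<bar>real n ^ 4 * (indicator {0..} z * \<phi> z)\<bar>"
      using trunc_kernel_bounds[of n x y z] by linarith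
    then have "\<bar>trunc_kernel K n x y z\<bar> * (\<bar>u x\<bar> * \<bar>u y\<bar>)
        \<le> \<bar>real n ^ 4 * (indicator {0..} z * \<phi> z)\<bar> * (\<bar>u x\<bar> * \<bar>u y\<bar>)"
      by (rule mult_right_mono) simp
    then show ?thesis by (simp add: abs_mult mult_ac)
  qed
  then show "AE w in zy_measure \<Otimes>\<^sub>M lborel. norm (flux n u w) \<le> norm
      ((\<lambda>(p, x). (case p of (z, y) \<Rightarrow> (real n ^ 4 * (indicator {0..} z * \<phi> z)) * u y) * u x) w)"
    by (auto simp: flux_def kappa_def case_prod_beta)
qed

text \<open>By the symmetry of \<open>K\<close>, the right-hand side of the truncated equation is the second
  difference in \<open>x\<close> of the flux; testing it moves the second difference to the test function.\<close>

lemma trunc_rhs_flux: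
  "trunc_rhs K n u x = (\<integral>p. flux n u (p, x + - fst p) \<partial>zy_measure)
     - 2 * (\<integral>p. flux n u (p, x) \<partial>zy_measure) + (\<integral>p. flux n u (p, x + fst p) \<partial>zy_measure)"
proof -
  have k: "kappa (trunc_kernel K n) u x y z = kappa (trunc_kernel K n) u y x z" for x y z
    by (simp add: kappa_def trunc_kernel_sym[of n x y z])
  \<comment> \<open>This lets the quadrant integrals of \<open>trunc_rhs\<close> be taken over the
    whole plane, where shears act freely.\<close>
  have k0: "0 \<le> z" "0 \<le> y" if "kappa (trunc_kernel K n) u x y z \<noteq> 0" for x y z
    using trunc_kernel_nonzeroD[of K n x y z] that by (auto simp: kappa_def)
  have "(LBINT p:{0..}\<times>{0..}. (case p of (z, y) \<Rightarrow> kappa (trunc_kernel K n) u y (x - z) z))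
      = (\<integral>p. flux n u (p, x + - fst p) \<partial>zy_measure)"
    unfolding set_lebesgue_integral_def lborel_prod[symmetric]
    by (intro Bochner_Integration.integral_cong refl)
      (auto simp: flux_def k[of _ "x - _"] indicator_def dest: k0)
  moreover have "(LBINT p:{0..}\<times>{0..}. (case p of (z, y) \<Rightarrow> kappa (trunc_kernel K n) u x y z))
      = (\<integral>p. flux n u (p, x) \<partial>zy_measure)"
    unfolding set_lebesgue_integral_def lborel_prod[symmetric]
    by (intro Bochner_Integration.integral_cong refl)
      (auto simp: flux_def indicator_def dest: k0)
  moreover have "(LBINT p:{0..}\<times>{0..}. (case p of (z, y) \<Rightarrow> kappa (trunc_kernel K n) u y x z))
      = (\<integral>p. flux n u (p, x) \<partial>zy_measure)"
    unfolding set_lebesgue_integral_def lborel_prod[symmetric]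
    by (intro Bochner_Integration.integral_cong refl)
      (auto simp: flux_def k[of _ x] indicator_def dest: k0)
  moreover have "(LBINT p:{0..}\<times>{0..}. (case p of (z, y) \<Rightarrow> kappa (trunc_kernel K n) u (x + z) y z))
      = (\<integral>p. flux n u (p, x + fst p) \<partial>zy_measure)"
    unfolding set_lebesgue_integral_def lborel_prod[symmetric]
    by (intro Bochner_Integration.integral_cong refl)
      (auto simp: flux_def indicator_def dest: k0)
  ultimately show ?thesis by (simp add: trunc_rhs_def Let_def)
qed

text \<open>An exchange seen by the truncated kernel starts and ends in the window, so neither gain
  nor loss occurs elsewhere.\<close>

lemma trunc_rhs_outside:
  assumes "x \<notin> {1 / real n<..<real n}"
  shows "trunc_rhs K n u x = 0"
proof -
  have support: "kappa (trunc_kernel K n) u a y z = 0" if "\<not> (1 / real n < a - z \<and> a + z < real n \<and> 0 < z)" for a y z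
    using trunc_kernel_nonzeroD(7,9,13)[of K n a y z] that by (cases "trunc_kernel K n a y z = 0") (auto simp: kappa_def)
  have "flux n u (p, x + - fst p) = 0" "flux n u (p, x) = 0" "flux n u (p, x + fst p) = 0" for p
    using assms by (auto simp: flux_def case_prod_beta intro!: support)
  then show ?thesis by (simp add: trunc_rhs_flux)
qed

lemma trunc_rhs_weak:
  assumes u: "integrable lborel u"
    and f: "f \<in> borel_measurable borel" and C: "\<And>x. \<bar>f x\<bar> \<le> C"
  shows "integrable lborel (\<lambda>x. f x * trunc_rhs K n u x)"
    and "integrable (zy_measure \<Otimes>\<^sub>M lborel) (\<lambda>w. second_diff (fst (fst w)) f (snd w) * flux n u w)"
    and "(\<integral>x. f x * trunc_rhs K n u x \<partial>lborel)
      = (\<integral>w. second_diff (fst (fst w)) f (snd w) * flux n u w \<partial>(zy_measure \<Otimes>\<^sub>M lborel))"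
proof -
  note G = flux_integrable[OF u, of n]
  \<comment> \<open>The shears by -z, z and 0 correspond to growth from x - z, shrinking from x + z
    and loss at x; they yield f (x + z), f (x - z) and f x.\<close>
  have s: "(\<lambda>p. - fst p) \<in> borel_measurable zy_measure" "fst \<in> borel_measurable zy_measure"
    "(\<lambda>_. 0) \<in> borel_measurable zy_measure"
    by measurable
  note R = integral_against_sheared_marginal[OF sigma_finite_lborel_pair s(1) G f C]
    integral_against_sheared_marginal[OF sigma_finite_lborel_pair s(2) G f C]
    integral_against_sheared_marginal[OF sigma_finite_lborel_pair s(3) G f C]
  have e1: "(\<lambda>x. f x * trunc_rhs K n u x) = (\<lambda>x. f x * (\<integral>p. flux n u (p, x + - fst p) \<partial>zy_measure)
      - 2 * (f x * (\<integral>p. flux n u (p, x + 0) \<partial>zy_measure)) + f x * (\<integral>p. flux n u (p, x + fst p) \<partial>zy_measure))"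
    by (simp add: trunc_rhs_flux algebra_simps)
  show "integrable lborel (\<lambda>x. f x * trunc_rhs K n u x)"
    unfolding e1 using R(1,4,7) by (intro Bochner_Integration.integrable_add Bochner_Integration.integrable_diff integrable_mult_right)
  have e2: "(\<lambda>w. second_diff (fst (fst w)) f (snd w) * flux n u w)
     = (\<lambda>w. (\<lambda>(p, x). f (x - - fst p) * flux n u (p, x)) w - 2 * (\<lambda>(p, x). f (x - 0) * flux n u (p, x)) w
        + (\<lambda>(p, x). f (x - fst p) * flux n u (p, x)) w)"
    by (auto simp: second_diff_def algebra_simps)
  show "integrable (zy_measure \<Otimes>\<^sub>M lborel) (\<lambda>w. second_diff (fst (fst w)) f (snd w) * flux n u w)"
    unfolding e2 using R(2,5,8) by (intro Bochner_Integration.integrable_add Bochner_Integration.integrable_diff integrable_mult_right)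
  have "(\<integral>x. f x * trunc_rhs K n u x \<partial>lborel) = (\<integral>x. f x * (\<integral>p. flux n u (p, x + - fst p) \<partial>zy_measure) \<partial>lborel)
      - 2 * (\<integral>x. f x * (\<integral>p. flux n u (p, x + 0) \<partial>zy_measure) \<partial>lborel)
      + (\<integral>x. f x * (\<integral>p. flux n u (p, x + fst p) \<partial>zy_measure) \<partial>lborel)"
    unfolding e1 by (rule integral_second_diff[OF R(1,7,4)])
  also have "\<dots> = (\<integral>w. second_diff (fst (fst w)) f (snd w) * flux n u w \<partial>(zy_measure \<Otimes>\<^sub>M lborel))"
    unfolding e2 R(3,6,9) by (rule integral_second_diff[OF R(2,8,5), symmetric])
  finally show "(\<integral>x. f x * trunc_rhs K n u x \<partial>lborel)
      = (\<integral>w. second_diff (fst (fst w)) f (snd w) * flux n u w \<partial>(zy_measure \<Otimes>\<^sub>M lborel))" .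
qed

lemma truncated_solution_integrable:
  assumes "truncated_solution K c0 n u" "0 \<le> t"
  shows "integrable lborel (u t)"
proof -
  have "set_integrable lborel {1 / real n<..<real n} (u t)" "\<And>x. x \<notin> {1 / real n<..<real n} \<Longrightarrow> u t x = 0"
    using assms by (auto simp: truncated_solution_def)
  moreover from this(2) have "(\<lambda>x. indicator {1 / real n<..<real n} x *\<^sub>R u t x) = u t"
    by (intro ext) (auto simp: indicator_def)
  ultimately show ?thesis unfolding set_integrable_def by metis
qed

text \<open>The solution is differentiable as a curve in L^1, and a bounded test function is a
  continuous linear functional on L^1. At time 0 the derivative is one-sided.\<close>

lemma truncated_solution_deriv:
  assumes sol: "truncated_solution K c0 n u"
    and f: "f \<in> borel_measurable borel" and C: "\<And>x. \<bar>f x\<bar> \<le> C" and "0 \<le> t"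
  shows "((\<lambda>s. \<integral>x. f x * u s x \<partial>lborel) has_real_derivative
     (\<integral>w. second_diff (fst (fst w)) f (snd w) * flux n (u t) w \<partial>(zy_measure \<Otimes>\<^sub>M lborel))) (at t within {0..})"
proof -
  note int = truncated_solution_integrable[OF sol]
  note W = trunc_rhs_weak[OF int[OF \<open>0 \<le> t\<close>] f C]
  define r where "r = trunc_rhs K n (u t)"
  \<comment> \<open>\<open>L1_dist\<close> integrates over the half-line, while the functionals here
    integrate over the whole line.\<close>
  have zero: "u s x = 0" "r x = 0" if "0 \<le> s" "x < 0" for s x
  proof -
    have "x \<notin> {1 / real n<..<real n}"
      using that by (auto simp: not_less intro: order_trans[of x 0])
    then show "u s x = 0" "r x = 0"
      using sol that trunc_rhs_outside by (auto simp: truncated_solution_def r_def)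
  qed
  have r: "integrable lborel r"
    using trunc_rhs_weak(1)[OF int[OF \<open>0 \<le> t\<close>], of "\<lambda>_. 1" 1 n] by (simp add: r_def)
  have fu: "integrable lborel (\<lambda>x. f x * g x)" if "integrable lborel g" for g
  proof (rule Bochner_Integration.integrable_bound)
    show "integrable lborel (\<lambda>x. C * g x)" using that by simp
    show "(\<lambda>x. f x * g x) \<in> borel_measurable lborel" using f that by auto
    show "AE x in lborel. norm (f x * g x) \<le> norm (C * g x)"
      using C by (intro AE_I2) (auto simp: abs_mult intro!: mult_right_mono order_trans[OF C])
  qed
  define d where "d = (\<lambda>s. L1_dist (\<lambda>x. (u s x - u t x) / (s - t)) r)"
  have d: "(d \<longlongrightarrow> 0) (at t within {0..})"
    using sol \<open>0 \<le> t\<close> by (simp add: truncated_solution_def d_def r_def)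
  define g where "g = (\<lambda>s. \<integral>x. f x * u s x \<partial>lborel)"
  have bound: "\<bar>(g s - g t) / (s - t) - (\<integral>x. f x * r x \<partial>lborel)\<bar> \<le> C * d s" if "0 \<le> s" for s
  proof -
    have i: "integrable lborel (\<lambda>x. (u s x - u t x) / (s - t) - r x)"
      using int \<open>0 \<le> t\<close> that r by auto
    have "(g s - g t) / (s - t) - (\<integral>x. f x * r x \<partial>lborel)
        = (\<integral>x. f x * ((u s x - u t x) / (s - t) - r x) \<partial>lborel)"
      using fu[OF int[OF \<open>0 \<le> t\<close>]] fu[OF int[OF that]] fu[OF r]
      by (simp add: g_def right_diff_distrib diff_divide_distrib)
    also have "\<bar>\<dots>\<bar> \<le> (\<integral>x. C * \<bar>(u s x - u t x) / (s - t) - r x\<bar> \<partial>lborel)"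
      using i fu[OF i]
      by (intro order_trans[OF integral_abs_bound] integral_mono integrable_mult_right integrable_abs)
        (auto simp only: abs_mult intro!: mult_right_mono C abs_ge_zero)
    also have "\<dots> = C * d s"
      unfolding d_def L1_dist_def set_lebesgue_integral_def integral_mult_right_zero
      using zero \<open>0 \<le> t\<close> that
      by (auto intro!: arg_cong[where f="\<lambda>x. C * x"] Bochner_Integration.integral_cong simp: indicator_def)
    finally show ?thesis .
  qed
  have "((\<lambda>s. (g s - g t) / (s - t) - (\<integral>x. f x * r x \<partial>lborel)) \<longlongrightarrow> 0) (at t within {0..})"
  proof (rule Lim_null_comparison)
    show "((\<lambda>s. C * d s) \<longlongrightarrow> 0) (at t within {0..})" using tendsto_mult_right_zero[OF d] by simp
    show "\<forall>\<^sub>F s in at t within {0..}. norm ((g s - g t) / (s - t) - (\<integral>x. f x * r x \<partial>lborel)) \<le> C * d s"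
      using bound by (auto simp: eventually_at_filter)
  qed
  then have "((\<lambda>s. (g s - g t) / (s - t)) \<longlongrightarrow> (\<integral>x. f x * r x \<partial>lborel)) (at t within {0..})"
    by (simp add: LIM_zero_iff)
  then show ?thesis using W(3) by (simp add: has_field_derivative_iff g_def r_def)
qed

end

text \<open>The term \<open>x powr (- 0)\<close> is the weight of \<open>Y\<close> for \<beta> = 0:
  it is 1 for x > 0 and 0 at the origin, where the left-hand side vanishes as well.\<close>

lemma powr_le_powr_sum:
  fixes x :: real
  assumes "0 \<le> x" "0 \<le> r" "r \<le> s"
  shows "x powr r \<le> x powr (- 0) + x powr s"
proof (cases "x \<le> 1")
  case True
  then have "x powr r \<le> x powr 0" if "0 < x"
    using that assms by (intro powr_mono') auto
  then show ?thesis using assms by (cases "x = 0") (auto intro: add_increasing2)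
next
  case False
  then have "x powr r \<le> x powr s" using assms by (intro powr_mono) auto
  then show ?thesis by (simp add: add_increasing)
qed

lemma Y_moment_integrable:
  assumes "c \<in> Y 0 s" "0 \<le> r" "r \<le> s"
  shows "set_integrable lborel {0..} (\<lambda>x. x powr r * c x)"
  unfolding set_integrable_def
proof (rule Bochner_Integration.integrable_bound)
  show "integrable lborel (\<lambda>x. indicator {0..} x *\<^sub>R ((x powr (- 0) + x powr s) * \<bar>c x\<bar>))"
    using assms by (simp add: Y_def set_integrable_def)
  have "(\<lambda>x. indicator {0..} x *\<^sub>R c x) \<in> borel_measurable lborel"
    using assms by (auto simp: Y_def set_integrable_def)
  then have "(\<lambda>x. x powr r * (indicator {0..} x *\<^sub>R c x)) \<in> borel_measurable lborel"
    by measurable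
  then show "(\<lambda>x. indicator {0..} x *\<^sub>R (x powr r * c x)) \<in> borel_measurable lborel"
    by (simp add: mult_ac)
  have "norm (indicator {0..} x *\<^sub>R (x powr r * c x))
      \<le> norm (indicator {0..} x *\<^sub>R ((x powr (- 0) + x powr s) * \<bar>c x\<bar>))" for x
  proof (cases "0 \<le> x")
    case True
    have "x powr r * \<bar>c x\<bar> \<le> (x powr (- 0) + x powr s) * \<bar>c x\<bar>"
      using powr_le_powr_sum[OF True assms(2,3)] by (rule mult_right_mono) simp
    moreover have "0 \<le> x powr (- 0) + x powr s" by simp
    ultimately show ?thesis using True by (simp only: abs_mult real_norm_def real_scaleR_def) simp
  qed simp
  then show "AE x in lborel. norm (indicator {0..} x *\<^sub>R (x powr r * c x))
      \<le> norm (indicator {0..} x *\<^sub>R ((x powr (- 0) + x powr s) * \<bar>c x\<bar>))"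
    by (intro AE_I2)
qed

section \<open>Lower bound for the growth rate of the mu-th moment\<close>

locale gelling_kernel = exchange_kernel +
  fixes \<phi>1 :: "real \<Rightarrow> real" and \<mu> :: real
  assumes mu: "1 < \<mu>" "\<mu> \<le> 2"
    and phi1: "\<phi>1 \<in> Y_pos 0 (1 + \<mu>)"
    and K_lower: "\<And>x y z. x \<ge> 0 \<Longrightarrow> y \<ge> 0 \<Longrightarrow> z \<ge> 0 \<Longrightarrow>
        \<phi>1 z * ((max 1 x)\<^sup>2 * max 1 y powr \<mu> + max 1 x powr \<mu> * (max 1 y)\<^sup>2)
          * indicator ({z<..} \<times> {z<..}) (x, y) \<le> K x y z"
begin

text \<open>The factor z^2 comes from the second difference. The positive part makes the density
  nonnegative everywhere, as \<phi>1 is nonnegative only almost everywhere.\<close>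

definition density :: "real \<Rightarrow> real" where
  "density z = indicator {0..} z * (z\<^sup>2 * max 0 (\<phi>1 z))"

text \<open>The margins are matched with those of \<open>cut_density\<close>: where both cuts are
  active, x - z > 1/N, z > 1/N and x + z < 2N, so that every cut-off of K_n is inactive for n >=
  2N.\<close>

definition cut_power :: "nat \<Rightarrow> real \<Rightarrow> real \<Rightarrow> real" where
  "cut_power N z x = (if z + 1 / real N < x \<and> x < real N then x powr \<mu> else 0)"

definition cut_density :: "nat \<Rightarrow> real \<Rightarrow> real" where
  "cut_density N z = (if 1 / real N < z \<and> z < real N then density z else 0)"

text \<open>This is the test function dual to the cut version of U: by Fubini, integrating U against
  the cut density equals integrating the solution against \<open>weight\<close>.\<close>

definition weight :: "nat \<Rightarrow> real \<Rightarrow> real" where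
  "weight N x = (\<integral>z. cut_density N z * cut_power N z x \<partial>lborel)"

definition full_weight :: "real \<Rightarrow> real" where
  "full_weight x = (\<integral>z. density z * (if z < x then x powr \<mu> else 0) \<partial>lborel)"

lemma density_nonneg: "0 \<le> density z"
  by (simp add: density_def)

lemma density_measurable [measurable]: "density \<in> borel_measurable borel"
proof -
  have [measurable]: "(\<lambda>x. indicator {0..} x *\<^sub>R \<phi>1 x) \<in> borel_measurable borel"
    using phi1 by (auto simp: Y_pos_def Y_def set_integrable_def)
  have "density = (\<lambda>z. z\<^sup>2 * max 0 (indicator {0..} z *\<^sub>R \<phi>1 z))"
    by (auto simp: density_def indicator_def)
  also have "\<dots> \<in> borel_measurable borel" by measurable
  finally show ?thesis .
qed

text \<open>Membership of \<phi>1 in Y_{0,1+mu} covers exactly this range of r. The endpoints r = 0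
  and r = mu - 1 produce the two moments of \<phi>1 in the theorem.\<close>

lemma density_moment:
  assumes "0 \<le> r" "r \<le> \<mu> - 1"
  shows "integrable lborel (\<lambda>z. z powr r * density z)"
    and "(\<integral>z. z powr r * density z \<partial>lborel) = moment (2 + r) \<phi>1"
proof -
  have i: "integrable lborel (\<lambda>x. indicator {0..} x *\<^sub>R (x powr (2 + r) * \<phi>1 x))"
    using Y_moment_integrable[of \<phi>1 "1 + \<mu>" "2 + r"] phi1 assms by (simp add: Y_pos_def set_integrable_def)
  have "AE z in lborel. z \<in> {0..} \<longrightarrow> 0 \<le> \<phi>1 z" "AE z in lborel. z \<noteq> (0 :: real)"
    using phi1 by (simp_all add: Y_pos_def AE_lborel_singleton)
  then have ae: "AE z in lborel. z powr r * density z = indicator {0..} z *\<^sub>R (z powr (2 + r) * \<phi>1 z)"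
  proof eventually_elim
    case (elim z)
    then show ?case
      by (cases "0 < z") (auto simp: density_def indicator_def powr_add)
  qed
  have m: "(\<lambda>z. z powr r * density z) \<in> borel_measurable lborel" by measurable
  show "integrable lborel (\<lambda>z. z powr r * density z)"
    by (rule integrable_cong_AE_imp[OF i m]) (use ae in \<open>eventually_elim, simp\<close>)
  show "(\<integral>z. z powr r * density z \<partial>lborel) = moment (2 + r) \<phi>1"
    unfolding moment_def set_lebesgue_integral_def using m i ae by (intro integral_cong_AE) auto
qed

lemma density_integrable: "integrable lborel density"
  and integral_density: "(\<integral>z. density z \<partial>lborel) = moment 2 \<phi>1"
proof -
  have ae: "AE z in lborel. z powr 0 * density z = density z"
    using AE_lborel_singleton[of "0 :: real"] by eventually_elim auto
  have m: "density \<in> borel_measurable lborel" by measurable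
  show "integrable lborel density"
    by (rule integrable_cong_AE_imp[OF density_moment(1)[of 0] m]) (use ae mu in auto)
  show "(\<integral>z. density z \<partial>lborel) = moment 2 \<phi>1"
    using density_moment(2)[of 0] mu integral_cong_AE[OF _ _ ae] m by simp
qed

lemma cut_density_measurable [measurable]: "cut_density N \<in> borel_measurable borel"
  unfolding cut_density_def by measurable

lemma cut_density_bounds: "0 \<le> cut_density N z" "cut_density N z \<le> density z"
  by (auto simp: cut_density_def density_nonneg)

lemma cut_density_integrable: "integrable lborel (cut_density N)"
  by (rule Bochner_Integration.integrable_bound[OF density_integrable])
    (auto simp: cut_density_bounds density_nonneg)

lemma cut_power_bounds: "0 \<le> cut_power N z x" "0 \<le> z \<Longrightarrow> cut_power N z x \<le> real N powr \<mu>"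
  using mu by (auto simp: cut_power_def intro!: powr_mono2 order_trans[of 0 "z + 1 / real N" x])

lemma cut_power_measurable [measurable]:
  assumes [measurable]: "f \<in> borel_measurable M" "g \<in> borel_measurable M"
  shows "(\<lambda>w. cut_power N (f w) (g w)) \<in> borel_measurable M"
  unfolding cut_power_def by measurable

lemma cut_product_le:
  "\<bar>cut_density N z * cut_power N z y\<bar> \<le> density z * real N powr \<mu>"
proof (cases "0 \<le> z")
  case True
  then show ?thesis using cut_density_bounds cut_power_bounds density_nonneg
    by (auto simp: abs_mult intro!: mult_mono)
next
  case False
  then have "cut_density N z = 0" by (simp add: cut_density_def density_def)
  then show ?thesis by (simp add: density_nonneg)
qed

lemma weight_measurable [measurable]: "weight N \<in> borel_measurable borel"
  unfolding weight_def by measurable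

text \<open>Off the cut region the left-hand side is zero and the right-hand side is nonnegative by
  convexity. Inside it the kernel is the original one, and keeping one of the two summands of its
  lower bound gives an expression symmetric in x and y.\<close>

lemma flux_ge:
  assumes "0 < N" "2 * N \<le> n" "0 \<le> u x" "0 \<le> u y"
  defines "f \<equiv> \<lambda>x. x powr \<mu> * indicator {1 / real n<..<real n} x"
  shows "\<mu> * (\<mu> - 1) * 2 powr (\<mu> - 2)
      * (cut_density N z * (cut_power N z y * u y) * (cut_power N z x * u x))
    \<le> second_diff z f x * flux n u ((z, y), x)"
proof -
  define \<kappa> where "\<kappa> = \<mu> * (\<mu> - 1) * 2 powr (\<mu> - 2)"
  have \<kappa>: "0 \<le> \<kappa>" using mu by (simp add: \<kappa>_def)
  have uu: "0 \<le> u x * u y" using assms by simp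
  have sd: "\<kappa> * (z\<^sup>2 * x powr (\<mu> - 2)) \<le> second_diff z f x"
    if "1 / real n < x - z" "x + z < real n" "0 < z"
  proof -
    have "0 \<le> 1 / real n" by simp
    then have "0 \<le> z" "z < x" using that by linarith+
    moreover have "second_diff z f x = second_diff z (\<lambda>x. x powr \<mu>) x"
      using that by (simp add: second_diff_def f_def)
    ultimately show ?thesis
      using second_diff_powr_ge[OF mu, of z x] unfolding \<kappa>_def by simp
  qed
  show ?thesis
  proof (cases "cut_density N z * cut_power N z y * cut_power N z x = 0")
    case True
    have "0 \<le> second_diff z f x * trunc_kernel K n x y z"
    proof (cases "trunc_kernel K n x y z = 0")
      case False
      show ?thesis using \<kappa> sd trunc_kernel_nonzeroD[OF False] trunc_kernel_bounds(1)[of n x y z]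
        by (intro mult_nonneg_nonneg order_trans[OF _ sd]) auto
    qed simp
    then have "0 \<le> second_diff z f x * flux n u ((z, y), x)"
      using mult_nonneg_nonneg[OF _ uu, of "second_diff z f x * trunc_kernel K n x y z"]
      by (simp add: flux_def kappa_def mult_ac)
    then show ?thesis using True by auto
  next
    case False
    then have z: "1 / real N < z" "z < real N" and x: "z + 1 / real N < x" "x < real N"
      and y: "z + 1 / real N < y" "y < real N" and dens: "cut_density N z = density z"
      by (auto simp: cut_density_def cut_power_def split: if_splits)
    \<comment> \<open>Here n >= 2N enters: x + z and y + z are below 2N, while x - z and y - z
      exceed 1/N.\<close>
    have n: "1 / real n \<le> 1 / real N" "2 * real N \<le> real n"
      using assms by (auto intro!: divide_left_mono)
    have "0 < 1 / real N" using assms by simp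
    then have pos: "0 < z" "0 < x" "0 < y" "z < x" "z < y" using z x y by linarith+
    have tk: "trunc_kernel K n x y z = K x y z"
      using n z x y pos by (auto simp: trunc_kernel_def indicator_def)
    have "max 0 (\<phi>1 z) * (x\<^sup>2 * y powr \<mu>) \<le> K x y z"
    proof (cases "0 \<le> \<phi>1 z")
      case True
      have "x\<^sup>2 * y powr \<mu> \<le> (max 1 x)\<^sup>2 * max 1 y powr \<mu> + max 1 x powr \<mu> * (max 1 y)\<^sup>2"
        using pos mu by (intro add_increasing2 mult_mono power_mono powr_mono2) auto
      then have "\<phi>1 z * (x\<^sup>2 * y powr \<mu>) \<le> \<phi>1 z * ((max 1 x)\<^sup>2 * max 1 y powr \<mu> + max 1 x powr \<mu> * (max 1 y)\<^sup>2)"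
        using True by (rule mult_left_mono)
      then show ?thesis using K_lower[of x y z] pos True by simp
    qed (use K_nonneg[of x y z] pos in auto)
    then have tk_ge: "max 0 (\<phi>1 z) * (x\<^sup>2 * y powr \<mu>) \<le> trunc_kernel K n x y z" by (simp add: tk)
    have sd': "\<kappa> * (z\<^sup>2 * x powr (\<mu> - 2)) \<le> second_diff z f x"
      using n z x pos by (intro sd) auto
    \<comment> \<open>The decay x^(mu-2) of the second difference is absorbed by the x^2 of the kept
      summand.\<close>
    have "x powr \<mu> = x powr (\<mu> - 2) * x\<^sup>2"
      using pos by (simp add: powr_diff)
    then have "\<kappa> * (cut_density N z * (cut_power N z y * u y) * (cut_power N z x * u x))
       = (\<kappa> * (z\<^sup>2 * x powr (\<mu> - 2))) * (max 0 (\<phi>1 z) * (x\<^sup>2 * y powr \<mu>)) * (u x * u y)"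
      using x y pos by (simp add: dens cut_power_def density_def mult_ac)
    also have "\<dots> \<le> second_diff z f x * trunc_kernel K n x y z * (u x * u y)"
      using sd' tk_ge by (intro mult_right_mono mult_mono order_trans[OF _ sd'] uu mult_nonneg_nonneg \<kappa>) auto
    finally show ?thesis by (simp add: \<kappa>_def flux_def kappa_def mult_ac)
  qed
qed

lemma AE_flux_pairs:
  fixes u :: "real \<Rightarrow> real"
  assumes [measurable]: "u \<in> borel_measurable borel" and "AE x in lborel. 0 \<le> u x"
  shows "AE w in zy_measure \<Otimes>\<^sub>M lborel. 0 \<le> u (snd (fst w)) \<and> 0 \<le> u (snd w)"
proof -
  interpret Q: pair_sigma_finite zy_measure "lborel :: real measure"
    unfolding pair_sigma_finite_def using sigma_finite_lborel_pair lborel.sigma_finite_measure_axioms by auto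
  have "AE p in zy_measure. 0 \<le> u (snd p)"
  proof (rule lborel_pair.AE_pair_measure)
    show "{p \<in> space zy_measure. 0 \<le> u (snd p)} \<in> sets zy_measure" by measurable
  qed (use assms in auto)
  then show ?thesis
  proof (intro Q.AE_pair_measure)
    show "{w \<in> space (zy_measure \<Otimes>\<^sub>M lborel). 0 \<le> u (snd (fst w)) \<and> 0 \<le> u (snd w)}
        \<in> sets (zy_measure \<Otimes>\<^sub>M lborel)" by measurable
  qed (use assms(2) in \<open>auto elim!: eventually_mono\<close>)
qed

text \<open>The tangent bound \<open>U\<^sup>2 \<ge> 2 l U - l\<^sup>2\<close> makes the estimate linear in \<open>u\<close>, so that it
  survives the weak limit.\<close>

lemma growth_rate_ge:
  assumes u: "integrable lborel u" and u_pos: "AE x in lborel. 0 \<le> u x"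
    and N: "0 < N" "2 * N \<le> n"
  defines "f \<equiv> \<lambda>x. x powr \<mu> * indicator {1 / real n<..<real n} x"
  shows "\<mu> * (\<mu> - 1) * 2 powr (\<mu> - 2) * (2 * l * (\<integral>x. weight N x * u x \<partial>lborel) - l\<^sup>2 * moment 2 \<phi>1)
    \<le> (\<integral>w. second_diff (fst (fst w)) f (snd w) * flux n u w \<partial>(zy_measure \<Otimes>\<^sub>M lborel))"
proof -
  define \<kappa> where "\<kappa> = \<mu> * (\<mu> - 1) * 2 powr (\<mu> - 2)"
  have \<kappa>: "0 \<le> \<kappa>" using mu by (simp add: \<kappa>_def)
  interpret Q: pair_sigma_finite zy_measure "lborel :: real measure"
    unfolding pair_sigma_finite_def using sigma_finite_lborel_pair lborel.sigma_finite_measure_axioms by auto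
  have [measurable]: "u \<in> borel_measurable borel" using u by auto
  \<comment> \<open>\<open>H\<close> is the lower bound of \<open>flux_ge\<close> without its
    constant. For fixed z it factorises, so integrating out x and then y yields U(z) twice;
    \<open>H2\<close> alone yields the linear term.\<close>
  define H2 where "H2 = (\<lambda>(z, y). cut_density N z * (cut_power N z y * u y))"
  define H where "H = (\<lambda>((z, y), x). cut_density N z * (cut_power N z y * u y) * (cut_power N z x * u x))"
  define U where "U = (\<lambda>z. \<integral>x. cut_power N z x * u x \<partial>lborel)"
  have H2: "integrable zy_measure H2"
  proof (rule Bochner_Integration.integrable_bound)
    show "integrable zy_measure (\<lambda>(z, y). (density z * real N powr \<mu>) * u y)"
      using density_integrable u
      by (intro integrable_tensor[OF lborel.sigma_finite_measure_axioms lborel.sigma_finite_measure_axioms]) auto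
    show "H2 \<in> borel_measurable zy_measure" unfolding H2_def by measurable
    have "\<bar>cut_density N z * (cut_power N z y * u y)\<bar> \<le> \<bar>(density z * real N powr \<mu>) * u y\<bar>" for z y
      using mult_right_mono[OF cut_product_le[of N z y], of "\<bar>u y\<bar>"] density_nonneg[of z]
      by (simp add: abs_mult mult.assoc)
    then show "AE w in zy_measure. norm (H2 w) \<le> norm ((\<lambda>(z, y). (density z * real N powr \<mu>) * u y) w)"
      by (auto simp: H2_def)
  qed
  have H: "integrable (zy_measure \<Otimes>\<^sub>M lborel) H"
  proof (rule Bochner_Integration.integrable_bound)
    show "integrable (zy_measure \<Otimes>\<^sub>M lborel) (\<lambda>(p, x). H2 p * (real N powr \<mu> * u x))"
      using H2 u
      by (intro integrable_tensor[OF sigma_finite_lborel_pair lborel.sigma_finite_measure_axioms]) auto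
    show "H \<in> borel_measurable (zy_measure \<Otimes>\<^sub>M lborel)" unfolding H_def case_prod_beta by measurable
    have "\<bar>H2 (z, y) * (cut_power N z x * u x)\<bar> \<le> \<bar>H2 (z, y) * (real N powr \<mu> * u x)\<bar>" for z y x
    proof (cases "0 \<le> z")
      case True
      then show ?thesis using cut_power_bounds
        by (auto simp: abs_mult intro!: mult_left_mono mult_right_mono)
    next
      case False
      then have "H2 (z, y) = 0" by (simp add: H2_def cut_density_def density_def)
      then show ?thesis by simp
    qed
    then show "AE w in zy_measure \<Otimes>\<^sub>M lborel. norm (H w) \<le> norm ((\<lambda>(p, x). H2 p * (real N powr \<mu> * u x)) w)"
      by (auto simp: H_def H2_def)
  qed
  have HU: "(\<integral>x. H ((z, y), x) \<partial>lborel) = H2 (z, y) * U z" for z y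
    by (simp add: H_def H2_def U_def)
  have H2U: "(\<integral>y. H2 (z, y) \<partial>lborel) = cut_density N z * U z" for z
    by (simp add: H2_def U_def)
  have iHU: "integrable zy_measure (\<lambda>(z, y). H2 (z, y) * U z)"
    using Q.integrable_fst'[OF H] by (simp add: HU[symmetric] case_prod_beta')
  have iU2: "integrable lborel (\<lambda>z. cut_density N z * U z * U z)"
    using lborel_pair.integrable_fst'[OF iHU] by (simp add: H2U)
  have iU: "integrable lborel (\<lambda>z. cut_density N z * U z)"
    using lborel_pair.integrable_fst'[OF H2] by (simp add: H2U)
  \<comment> \<open>Interchanging the integrations turns the integral of U into a functional linear
    in \<open>u\<close>, with \<open>weight N\<close> as test function.\<close>
  have "(\<integral>z. cut_density N z * U z \<partial>lborel) = (\<integral>x. \<integral>z. H2 (z, x) \<partial>lborel \<partial>lborel)"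
    using lborel_pair.integral_fst'[OF H2] lborel_pair.integral_snd[of "\<lambda>z y. H2 (z, y)"] H2
    by (simp add: H2U)
  also have "\<dots> = (\<integral>x. weight N x * u x \<partial>lborel)"
    by (simp add: H2_def weight_def mult.assoc[symmetric])
  finally have wU: "(\<integral>z. cut_density N z * U z \<partial>lborel) = (\<integral>x. weight N x * u x \<partial>lborel)" .
  \<comment> \<open>The mass of the cut density enters with the factor -l^2, so an upper bound
    independent of \<open>N\<close> suffices.\<close>
  have "(\<integral>z. cut_density N z \<partial>lborel) \<le> moment 2 \<phi>1"
    unfolding integral_density[symmetric]
    by (intro integral_mono cut_density_integrable density_integrable cut_density_bounds)
  then have "2 * l * (\<integral>x. weight N x * u x \<partial>lborel) - l\<^sup>2 * moment 2 \<phi>1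
      \<le> 2 * l * (\<integral>z. cut_density N z * U z \<partial>lborel) - l\<^sup>2 * (\<integral>z. cut_density N z \<partial>lborel)"
    unfolding wU by (intro diff_left_mono mult_left_mono) auto
  also have "\<dots> = (\<integral>z. 2 * l * (cut_density N z * U z) - l\<^sup>2 * cut_density N z \<partial>lborel)"
    using iU cut_density_integrable by simp
  also have "\<dots> \<le> (\<integral>z. cut_density N z * U z * U z \<partial>lborel)"
  proof (rule integral_mono)
    show "integrable lborel (\<lambda>z. 2 * l * (cut_density N z * U z) - l\<^sup>2 * cut_density N z)"
      using iU cut_density_integrable by simp
    fix z
    have "0 \<le> cut_density N z * (U z - l)\<^sup>2" using cut_density_bounds by simp
    then show "2 * l * (cut_density N z * U z) - l\<^sup>2 * cut_density N z \<le> cut_density N z * U z * U z"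
      by (simp add: power2_eq_square algebra_simps)
  qed (rule iU2)
  also have "\<dots> = integral\<^sup>L zy_measure (\<lambda>(z, y). H2 (z, y) * U z)"
    using lborel_pair.integral_fst'[OF iHU] by (simp add: H2U)
  also have "\<dots> = integral\<^sup>L (zy_measure \<Otimes>\<^sub>M lborel) H"
    using Q.integral_fst'[OF H] by (simp add: HU[symmetric] case_prod_beta')
  finally have "\<kappa> * (2 * l * (\<integral>x. weight N x * u x \<partial>lborel) - l\<^sup>2 * moment 2 \<phi>1)
      \<le> \<kappa> * integral\<^sup>L (zy_measure \<Otimes>\<^sub>M lborel) H"
    using \<kappa> by (rule mult_left_mono)
  also have "\<dots> = (\<integral>w. \<kappa> * H w \<partial>(zy_measure \<Otimes>\<^sub>M lborel))" by simp
  also have "\<dots> \<le> (\<integral>w. second_diff (fst (fst w)) f (snd w) * flux n u w \<partial>(zy_measure \<Otimes>\<^sub>M lborel))"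
  proof (rule integral_mono_AE)
    show "integrable (zy_measure \<Otimes>\<^sub>M lborel) (\<lambda>w. \<kappa> * H w)" using H by simp
    have f_bound: "\<bar>f x\<bar> \<le> real n powr \<mu>" for x
      using mu by (auto simp: f_def indicator_def intro!: powr_mono2 order_trans[of 0 "1 / real n" x])
    have "f \<in> borel_measurable borel" unfolding f_def by measurable
    then show "integrable (zy_measure \<Otimes>\<^sub>M lborel) (\<lambda>w. second_diff (fst (fst w)) f (snd w) * flux n u w)"
      by (rule trunc_rhs_weak(2)[OF u _ f_bound])
    show "AE w in zy_measure \<Otimes>\<^sub>M lborel. \<kappa> * H w \<le> second_diff (fst (fst w)) f (snd w) * flux n u w"
      using AE_flux_pairs[OF \<open>u \<in> borel_measurable borel\<close> u_pos]
    proof eventually_elim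
      case (elim w)
      then show ?case
        using flux_ge[OF N, of u "snd w" "snd (fst w)" "fst (fst w)"]
        by (simp add: H_def \<kappa>_def f_def case_prod_beta)
    qed
  qed
  finally show ?thesis unfolding \<kappa>_def .
qed

end

text \<open>Subtracting the line of slope \<open>B\<close> reduces this to monotonicity. The
  derivative at 0 is one-sided, hence derivatives are used at interior times only and continuity
  covers the endpoints.\<close>

lemma growth_from_derivative_bound:
  fixes g :: "real \<Rightarrow> real"
  assumes deriv: "\<And>r. 0 \<le> r \<Longrightarrow> (g has_real_derivative g' r) (at r within {0..})"
    and "0 \<le> s" "s \<le> t" and bound: "\<And>r. s \<le> r \<Longrightarrow> r \<le> t \<Longrightarrow> B \<le> g' r"
  shows "B * (t - s) \<le> g t - g s"
proof -
  have "g s - B * s \<le> g t - B * t"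
  proof (rule DERIV_nonneg_imp_increasing_open[OF \<open>s \<le> t\<close>])
    fix r assume r: "s < r" "r < t"
    then have "at r within {0..} = at r" using assms by (intro at_within_interior) auto
    then have "((\<lambda>r. g r - B * r) has_real_derivative g' r - B) (at r)"
      using deriv[of r] r assms by (auto intro!: derivative_eq_intros)
    then show "\<exists>y. ((\<lambda>r. g r - B * r) has_real_derivative y) (at r) \<and> 0 \<le> y"
      using bound[of r] r by force
  next
    have "continuous_on {0..} g"
      using deriv by (auto simp: continuous_on_eq_continuous_within intro: DERIV_continuous)
    then show "continuous_on {s..t} (\<lambda>r. g r - B * r)"
      using assms by (intro continuous_intros) (auto elim: continuous_on_subset)
  qed
  then show ?thesis by (simp add: algebra_simps)
qed

section \<open>The weights and their limit as the second cut is removed\<close>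

context gelling_kernel
begin

lemma weight_integrand_integrable: "integrable lborel (\<lambda>z. cut_density N z * cut_power N z x)"
proof (rule Bochner_Integration.integrable_bound)
  show "integrable lborel (\<lambda>z. density z * real N powr \<mu>)" using density_integrable by simp
  show "AE z in lborel. norm (cut_density N z * cut_power N z x) \<le> norm (density z * real N powr \<mu>)"
    using cut_product_le density_nonneg by simp
qed measurable

lemma weight_nonneg: "0 \<le> weight N x"
  unfolding weight_def using cut_density_bounds cut_power_bounds by simp

lemma weight_le: "weight N x \<le> moment 2 \<phi>1 * x powr \<mu>"
proof -
  have "weight N x \<le> (\<integral>z. density z * x powr \<mu> \<partial>lborel)"
    unfolding weight_def
    by (intro integral_mono weight_integrand_integrable)
      (auto intro!: mult_mono mult_nonneg_nonneg cut_density_bounds density_nonneg simp: density_integrable cut_power_def)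
  then show ?thesis by (simp add: integral_density)
qed

lemma weight_mono:
  assumes "0 < N"
  shows "weight N x \<le> weight (Suc N) x"
proof -
  have "1 / real (Suc N) \<le> 1 / real N" using assms by (intro divide_left_mono) auto
  then show ?thesis
    unfolding weight_def
    by (intro integral_mono weight_integrand_integrable mult_mono)
      (auto simp: cut_density_def cut_power_def density_nonneg)
qed

lemma full_weight_integrable: "integrable lborel (\<lambda>z. density z * (if z < x then x powr \<mu> else 0))"
proof (rule Bochner_Integration.integrable_bound)
  show "integrable lborel (\<lambda>z. density z * x powr \<mu>)" using density_integrable by simp
qed (auto simp: density_nonneg)

text \<open>For 0 < z < x all cuts become inactive once N is large, and density(z) x^mu dominates.
  The index starts at 1, matching the condition 0 < N of \<open>weight_mono\<close> and
  \<open>flux_ge\<close>.\<close>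

lemma weight_tendsto: "(\<lambda>N. weight (Suc N) x) \<longlonglongrightarrow> full_weight x"
  unfolding weight_def full_weight_def
proof (rule integral_dominated_convergence)
  show "integrable lborel (\<lambda>z. density z * x powr \<mu>)" using density_integrable by simp
  show "AE z in lborel. norm (cut_density (Suc N) z * cut_power (Suc N) z x) \<le> density z * x powr \<mu>" for N
    using cut_density_bounds cut_power_bounds(1)
    by (intro AE_I2) (auto simp: abs_mult cut_power_def intro!: mult_mono mult_nonneg_nonneg density_nonneg)
  have "(\<lambda>N. cut_density (Suc N) z * cut_power (Suc N) z x) \<longlonglongrightarrow> density z * (if z < x then x powr \<mu> else 0)" for z
  proof (cases "0 < z \<and> z < x")
    case True
    have inv: "(\<lambda>N. 1 / real (Suc N)) \<longlonglongrightarrow> 0"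
      by (rule LIMSEQ_Suc[OF lim_1_over_n])
    have large: "filterlim (\<lambda>N. real (Suc N)) at_top sequentially"
      by (rule filterlim_compose[OF filterlim_real_sequentially filterlim_Suc])
    have "\<forall>\<^sub>F N in sequentially. 1 / real (Suc N) < z" "\<forall>\<^sub>F N in sequentially. 1 / real (Suc N) < x - z"
      using order_tendstoD(2)[OF inv] True by auto
    moreover have "\<forall>\<^sub>F N in sequentially. z < real (Suc N)" "\<forall>\<^sub>F N in sequentially. x < real (Suc N)"
      using large unfolding filterlim_at_top_dense by auto
    ultimately have "\<forall>\<^sub>F N in sequentially. cut_density (Suc N) z * cut_power (Suc N) z x
        = density z * (if z < x then x powr \<mu> else 0)"
      by eventually_elim (use True in \<open>auto simp: cut_density_def cut_power_def\<close>)
    then show ?thesis by (rule tendsto_eventually)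
  next
    case False
    then have "density z = 0 \<or> x \<le> z" by (cases "z = 0") (auto simp: density_def)
    moreover have "\<not> z + 1 / real (Suc N) < x" if "x \<le> z" for N
      using that by (smt (verit) of_nat_0_le_iff zero_le_divide_1_iff)
    ultimately have "cut_density (Suc N) z * cut_power (Suc N) z x = density z * (if z < x then x powr \<mu> else 0)" for N
      by (cases "density z = 0") (auto simp: cut_power_def cut_density_def)
    then show ?thesis by simp
  qed
  then show "AE z in lborel. (\<lambda>N. cut_density (Suc N) z * cut_power (Suc N) z x)
      \<longlonglongrightarrow> density z * (if z < x then x powr \<mu> else 0)" by simp
qed measurable

text \<open>The missing range x <= z satisfies x^mu <= z^(mu-1) x, so restoring it costs at most
  M_{1+mu}(phi1) x. The cost is linear in x, so it is controlled by the first moment; this is the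
  origin of the correction term in the theorem.\<close>

lemma full_weight_ge:
  assumes "0 \<le> x"
  shows "moment 2 \<phi>1 * x powr \<mu> - moment (1 + \<mu>) \<phi>1 * x \<le> full_weight x"
proof -
  have i: "integrable lborel (\<lambda>z. z powr (\<mu> - 1) * density z)"
    and m: "(\<integral>z. z powr (\<mu> - 1) * density z \<partial>lborel) = moment (1 + \<mu>) \<phi>1"
    using density_moment[of "\<mu> - 1"] mu by (auto simp: add.commute)
  have "moment 2 \<phi>1 * x powr \<mu> - moment (1 + \<mu>) \<phi>1 * x
      = (\<integral>z. density z * x powr \<mu> - z powr (\<mu> - 1) * density z * x \<partial>lborel)"
    using i density_integrable by (simp add: m integral_density)
  also have "\<dots> \<le> full_weight x"
    unfolding full_weight_def
  proof (rule integral_mono[OF _ full_weight_integrable])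
    show "integrable lborel (\<lambda>z. density z * x powr \<mu> - z powr (\<mu> - 1) * density z * x)"
      using i density_integrable by simp
    fix z
    have "x powr \<mu> \<le> z powr (\<mu> - 1) * x" if "x \<le> z"
    proof -
      have "x powr (\<mu> - 1) * x \<le> z powr (\<mu> - 1) * x"
        using that assms mu by (intro mult_right_mono powr_mono2) auto
      then show ?thesis using assms mu by (cases "x = 0") (auto simp: powr_diff)
    qed
    then have "x powr \<mu> - z powr (\<mu> - 1) * x \<le> (if z < x then x powr \<mu> else 0)"
      using assms by auto
    then have "density z * (x powr \<mu> - z powr (\<mu> - 1) * x) \<le> density z * (if z < x then x powr \<mu> else 0)"
      by (rule mult_left_mono[OF _ density_nonneg])
    then show "density z * x powr \<mu> - z powr (\<mu> - 1) * density z * x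
        \<le> density z * (if z < x then x powr \<mu> else 0)"
      by (simp add: algebra_simps)
  qed
  finally show ?thesis .
qed

lemma full_weight_le: "full_weight x \<le> moment 2 \<phi>1 * x powr \<mu>"
  by (rule LIMSEQ_le_const2[OF weight_tendsto]) (auto intro: weight_le)

lemma full_weight_nonneg: "0 \<le> full_weight x"
  by (rule LIMSEQ_le_const[OF weight_tendsto]) (auto intro: weight_nonneg)

lemma full_weight_measurable [measurable]: "full_weight \<in> borel_measurable borel"
  unfolding full_weight_def by measurable

end

section \<open>Passage from the truncated solutions to the limit\<close>

lemma powr_le_one_plus_square:
  fixes x :: real
  assumes "0 \<le> x" "0 \<le> r" "r \<le> 2"
  shows "x powr r \<le> 1 + x\<^sup>2"
  using powr_le_powr_sum[OF assms] assms(1) by (auto split: if_splits)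

locale gelling_solution = gelling_kernel +
  fixes c0 :: "real \<Rightarrow> real" and T :: real and c :: "real \<Rightarrow> real \<Rightarrow> real"
    and cn :: "nat \<Rightarrow> real \<Rightarrow> real \<Rightarrow> real" and \<nu> :: "nat \<Rightarrow> nat"
  assumes c_pos: "\<And>t. 0 \<le> t \<Longrightarrow> t < T \<Longrightarrow> c t \<in> Y_pos 0 2"
    and sol: "\<And>n. 2 \<le> n \<Longrightarrow> truncated_solution K c0 n (cn n)"
    and \<nu>: "strict_mono \<nu>" "\<And>k. 2 \<le> \<nu> k"
    and conv: "\<And>S g. 0 \<le> S \<Longrightarrow> S < T \<Longrightarrow> g \<in> L_infty \<Longrightarrow>
      uniform_limit {0..S} (\<lambda>k t. LBINT x:{0..}. g x * (1 + x\<^sup>2) * cn (\<nu> k) t x)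
        (\<lambda>t. LBINT x:{0..}. g x * (1 + x\<^sup>2) * c t x) sequentially"
begin

text \<open>The cut makes an unbounded \<open>f\<close> admissible in
  \<open>truncated_solution_deriv\<close>, and it leaves the integral unchanged because the
  truncated solution vanishes off the window.\<close>

definition trunc_test :: "(real \<Rightarrow> real) \<Rightarrow> nat \<Rightarrow> real \<Rightarrow> real" where
  "trunc_test f n x = f x * indicator {1 / real n<..<real n} x"

definition functional :: "(real \<Rightarrow> real) \<Rightarrow> real \<Rightarrow> real" where
  "functional f t = (LBINT x:{0..}. f x * c t x)"

definition approx :: "(real \<Rightarrow> real) \<Rightarrow> nat \<Rightarrow> real \<Rightarrow> real" where
  "approx f k t = (\<integral>x. trunc_test f (\<nu> k) x * cn (\<nu> k) t x \<partial>lborel)"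

definition rate :: "(real \<Rightarrow> real) \<Rightarrow> nat \<Rightarrow> real \<Rightarrow> real" where
  "rate f k t = (\<integral>w. second_diff (fst (fst w)) (trunc_test f (\<nu> k)) (snd w) * flux (\<nu> k) (cn (\<nu> k) t) w
      \<partial>(zy_measure \<Otimes>\<^sub>M lborel))"

text \<open>These are the functions that weak convergence in Y_{0,2} can test: f / (1 + x^2) is
  bounded. The powers x and x^mu belong to them because mu <= 2.\<close>

definition test_function :: "(real \<Rightarrow> real) \<Rightarrow> bool" where
  "test_function f \<longleftrightarrow> f \<in> borel_measurable borel \<and> (\<exists>C\<ge>0. \<forall>x\<ge>0. \<bar>f x\<bar> \<le> C * (1 + x\<^sup>2))"

lemma sol_outside: "0 \<le> t \<Longrightarrow> x \<notin> {1 / real (\<nu> k)<..<real (\<nu> k)} \<Longrightarrow> cn (\<nu> k) t x = 0"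
  using sol[OF \<nu>(2)] by (simp add: truncated_solution_def)

lemma approx_uniform_limit:
  assumes f: "test_function f" and t: "0 \<le> t" "t < T"
  shows "uniform_limit {0..t} (approx f) (functional f) sequentially"
proof -
  obtain C where m[measurable]: "f \<in> borel_measurable borel" and C: "\<And>x. 0 \<le> x \<Longrightarrow> \<bar>f x\<bar> \<le> C * (1 + x\<^sup>2)"
    using f by (auto simp: test_function_def)
  define g where "g = (\<lambda>x. f x / (1 + x\<^sup>2))"
  have pos: "0 < 1 + x\<^sup>2" for x :: real by (simp add: add_pos_nonneg)
  have "\<bar>g x\<bar> \<le> C" if "0 \<le> x" for x
    using C[OF that] pos[of x] by (simp add: g_def abs_divide divide_le_eq)
  moreover have "g \<in> borel_measurable borel" unfolding g_def by measurable
  ultimately have "g \<in> L_infty"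
    unfolding L_infty_def set_borel_measurable_def by (auto intro!: exI[of _ C])
  then have lim: "uniform_limit {0..t} (\<lambda>k r. LBINT x:{0..}. g x * (1 + x\<^sup>2) * cn (\<nu> k) r x)
        (\<lambda>r. LBINT x:{0..}. g x * (1 + x\<^sup>2) * c r x) sequentially"
    by (rule conv[OF t])
  have g: "g x * (1 + x\<^sup>2) = f x" for x using pos[of x] by (simp add: g_def)
  have "(LBINT x:{0..}. f x * cn (\<nu> k) r x) = approx f k r" if "0 \<le> r" for k r
    unfolding set_lebesgue_integral_def approx_def
  proof (rule Bochner_Integration.integral_cong[OF refl])
    fix x
    have "0 \<le> 1 / real (\<nu> k)" by simp
    then have "0 \<le> x" if "x \<in> {1 / real (\<nu> k)<..<real (\<nu> k)}"
      using that unfolding greaterThanLessThan_iff by linarith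
    then show "indicator {0..} x *\<^sub>R (f x * cn (\<nu> k) r x) = trunc_test f (\<nu> k) x * cn (\<nu> k) r x"
      using sol_outside[OF \<open>0 \<le> r\<close>, of x k]
      by (cases "x \<in> {1 / real (\<nu> k)<..<real (\<nu> k)}") (auto simp: trunc_test_def)
  qed
  moreover have "uniform_limit {0..t} (\<lambda>k r. LBINT x:{0..}. f x * cn (\<nu> k) r x) (functional f) sequentially"
    using lim by (simp add: g functional_def[abs_def])
  ultimately show ?thesis
    by (subst (asm) uniform_limit_cong'[of "{0..t}" _ "approx f" _ "functional f"]) auto
qed

lemma approx_deriv:
  assumes f: "test_function f" and "0 \<le> r"
  shows "(approx f k has_real_derivative rate f k r) (at r within {0..})"
proof -
  obtain C where m[measurable]: "f \<in> borel_measurable borel"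
    and C: "0 \<le> C" "\<And>x. 0 \<le> x \<Longrightarrow> \<bar>f x\<bar> \<le> C * (1 + x\<^sup>2)"
    using f by (auto simp: test_function_def)
  have "\<bar>trunc_test f (\<nu> k) x\<bar> \<le> C * (1 + (real (\<nu> k))\<^sup>2)" for x
  proof (cases "x \<in> {1 / real (\<nu> k)<..<real (\<nu> k)}")
    case True
    have "0 \<le> 1 / real (\<nu> k)" by simp
    then have x: "0 \<le> x" "x \<le> real (\<nu> k)" using True unfolding greaterThanLessThan_iff by linarith+
    then have "C * (1 + x\<^sup>2) \<le> C * (1 + (real (\<nu> k))\<^sup>2)"
      using C(1) by (intro mult_left_mono add_left_mono power_mono) auto
    then show ?thesis using C(2)[OF x(1)] True by (simp add: trunc_test_def)
  qed (use C in \<open>simp add: trunc_test_def\<close>)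
  moreover have "trunc_test f (\<nu> k) \<in> borel_measurable borel"
    unfolding trunc_test_def by measurable
  ultimately show ?thesis
    using truncated_solution_deriv[OF sol[OF \<nu>(2)], of "trunc_test f (\<nu> k)"] \<open>0 \<le> r\<close>
    unfolding approx_def[abs_def] rate_def by blast
qed

lemma approx_continuous:
  assumes "test_function f"
  shows "continuous_on {0..t} (approx f k)"
proof -
  have "continuous_on {0..} (approx f k)"
    using approx_deriv[OF assms] by (auto simp: continuous_on_eq_continuous_within intro: DERIV_continuous)
  then show ?thesis by (rule continuous_on_subset) auto
qed

text \<open>For f of quadratic growth, continuity in L^1 with a bound in Y_{0,2} would not be
  enough. Continuity is instead inherited from the differentiable approximations by uniform
  convergence; \<open>dini_lower\<close> relies on it.\<close>

lemma functional_continuous: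
  assumes "test_function f" "0 \<le> t" "t < T"
  shows "continuous_on {0..t} (functional f)"
  by (rule uniform_limit_theorem[OF _ approx_uniform_limit[OF assms]])
    (auto intro!: always_eventually approx_continuous assms)

lemma approx_tendsto:
  assumes "test_function f" "0 \<le> t" "t < T"
  shows "(\<lambda>k. approx f k t) \<longlonglongrightarrow> functional f t"
  using assms by (intro tendsto_uniform_limitI[OF approx_uniform_limit[OF assms]]) auto

lemma functional_integrable:
  assumes f: "test_function f" and t: "0 \<le> t" "t < T"
  shows "set_integrable lborel {0..} (\<lambda>x. f x * c t x)"
proof -
  obtain C where m[measurable]: "f \<in> borel_measurable borel"
    and C: "0 \<le> C" "\<And>x. 0 \<le> x \<Longrightarrow> \<bar>f x\<bar> \<le> C * (1 + x\<^sup>2)"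
    using f by (auto simp: test_function_def)
  show ?thesis
    unfolding set_integrable_def
  proof (rule Bochner_Integration.integrable_bound)
  have Y: "c t \<in> Y 0 2" using c_pos[OF t] by (simp add: Y_pos_def)
  have i: "integrable lborel (\<lambda>x. indicator {0..} x *\<^sub>R c t x)"
    "integrable lborel (\<lambda>x. indicator {0..} x *\<^sub>R (x powr 2 * c t x))"
    using Y Y_moment_integrable[OF Y, of 2] by (auto simp: Y_def set_integrable_def)
  then show "integrable lborel (\<lambda>x. C * (\<bar>indicator {0..} x *\<^sub>R c t x\<bar> + \<bar>indicator {0..} x *\<^sub>R (x powr 2 * c t x)\<bar>))"
    by (intro integrable_mult_right Bochner_Integration.integrable_add integrable_abs)
  have "(\<lambda>x. f x * (indicator {0..} x *\<^sub>R c t x)) \<in> borel_measurable lborel"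
    using i(1) by measurable
  then show "(\<lambda>x. indicator {0..} x *\<^sub>R (f x * c t x)) \<in> borel_measurable lborel"
    by (simp add: mult_ac)
  have "\<bar>f x * c t x\<bar> \<le> C * (\<bar>c t x\<bar> + \<bar>x powr 2 * c t x\<bar>)" if "0 \<le> x" for x
    using mult_right_mono[OF C(2)[OF that], of "\<bar>c t x\<bar>"] that by (simp add: abs_mult algebra_simps)
  then show "AE x in lborel. norm (indicator {0..} x *\<^sub>R (f x * c t x))
      \<le> norm (C * (\<bar>indicator {0..} x *\<^sub>R c t x\<bar> + \<bar>indicator {0..} x *\<^sub>R (x powr 2 * c t x)\<bar>))"
    using C(1) by (intro AE_I2) (auto simp: indicator_def)
  qed
qed

lemma functional_mono:
  assumes f: "test_function f" "test_function g" and t: "0 \<le> t" "t < T"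
    and le: "\<And>x. 0 \<le> x \<Longrightarrow> f x \<le> g x"
  shows "functional f t \<le> functional g t"
proof -
  have "AE x in lborel. x \<in> {0..} \<longrightarrow> 0 \<le> c t x" using c_pos[OF t] by (simp add: Y_pos_def)
  then have "AE x in lborel. indicator {0..} x *\<^sub>R (f x * c t x) \<le> indicator {0..} x *\<^sub>R (g x * c t x)"
    by eventually_elim (auto simp: indicator_def intro!: mult_right_mono le)
  then show ?thesis
    using functional_integrable[OF f(1) t] functional_integrable[OF f(2) t]
    unfolding functional_def set_lebesgue_integral_def set_integrable_def by (intro integral_mono_AE)
qed

lemma test_function_id: "test_function (\<lambda>x. x)"
  unfolding test_function_def
proof (intro conjI exI[of _ 1] allI impI)
  fix x :: real
  have "0 \<le> (1 - \<bar>x\<bar>)\<^sup>2" by simp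
  then have "2 * \<bar>x\<bar> \<le> 1 + x\<^sup>2" by (simp add: power2_diff)
  then show "\<bar>x\<bar> \<le> 1 * (1 + x\<^sup>2)" by simp
qed auto

lemma test_function_powr: "test_function (\<lambda>x. x powr \<mu>)"
  unfolding test_function_def using mu
  by (intro conjI exI[of _ 1]) (auto intro: powr_le_one_plus_square)

lemma moment_2_nonneg: "0 \<le> moment 2 \<phi>1"
  unfolding integral_density[symmetric] by (simp add: density_nonneg)

lemma test_function_weights: "test_function (weight N)" "test_function full_weight"
proof -
  have "moment 2 \<phi>1 * x powr \<mu> \<le> moment 2 \<phi>1 * (1 + x\<^sup>2)" if "0 \<le> x" for x
    using that mu by (intro mult_left_mono powr_le_one_plus_square moment_2_nonneg) auto
  then have "\<bar>weight N x\<bar> \<le> moment 2 \<phi>1 * (1 + x\<^sup>2)" "\<bar>full_weight x\<bar> \<le> moment 2 \<phi>1 * (1 + x\<^sup>2)" if "0 \<le> x" for x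
    using that weight_nonneg[of N x] weight_le[of N x] full_weight_nonneg[of x] full_weight_le[of x]
    by force+
  then show "test_function (weight N)" "test_function full_weight"
    unfolding test_function_def using moment_2_nonneg by auto
qed

text \<open>The second difference of x is zero, and the window is invisible on the support of the
  flux. So each truncated solution conserves its first moment exactly, and the identity passes to
  the limit.\<close>

lemma first_moment_conserved:
  assumes t: "0 \<le> t" "t < T"
  shows "functional (\<lambda>x. x) t = functional (\<lambda>x. x) 0"
proof -
  have zero: "rate (\<lambda>x. x) k r = 0" for k r
  proof -
    have "second_diff z (trunc_test (\<lambda>x. x) n) x * flux n u ((z, y), x) = 0" for n z x y u
    proof (cases "trunc_kernel K n x y z = 0")
      case False
      show ?thesis
        using trunc_kernel_nonzeroD[OF False] by (simp add: second_diff_def trunc_test_def)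
    qed (simp add: flux_def kappa_def)
    then have "(\<lambda>w. second_diff (fst (fst w)) (trunc_test (\<lambda>x. x) (\<nu> k)) (snd w) * flux (\<nu> k) (cn (\<nu> k) r) w) = (\<lambda>_. 0)"
      by (metis prod.collapse)
    then show ?thesis by (simp add: rate_def)
  qed
  have "approx (\<lambda>x. x) k t = approx (\<lambda>x. x) k 0" for k
  proof (rule antisym)
    have "0 * (t - 0) \<le> approx (\<lambda>x. x) k t - approx (\<lambda>x. x) k 0"
      by (rule growth_from_derivative_bound[OF approx_deriv[OF test_function_id]]) (use t zero in auto)
    then show "approx (\<lambda>x. x) k 0 \<le> approx (\<lambda>x. x) k t" by simp
    \<comment> \<open>The growth lemma is one-sided; the negated functional gives the reverse
      inequality.\<close>
    have "0 * (t - 0) \<le> - approx (\<lambda>x. x) k t - - approx (\<lambda>x. x) k 0"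
      by (rule growth_from_derivative_bound[OF DERIV_minus[OF approx_deriv[OF test_function_id]]])
        (use t zero in auto)
    then show "approx (\<lambda>x. x) k t \<le> approx (\<lambda>x. x) k 0" by simp
  qed
  then show ?thesis
    using approx_tendsto[OF test_function_id t] approx_tendsto[OF test_function_id order_refl] t
    by (auto intro: LIMSEQ_unique)
qed

text \<open>The tangent point \<open>l\<close> stays free: l = 0 yields monotonicity of the mu-th
  moment, l = m(s) the quadratic growth.\<close>

lemma rate_ge:
  assumes "0 \<le> r" "0 < N" "2 * N \<le> \<nu> k"
  shows "\<mu> * (\<mu> - 1) * 2 powr (\<mu> - 2) * (2 * l * approx (weight N) k r - l\<^sup>2 * moment 2 \<phi>1)
    \<le> rate (\<lambda>x. x powr \<mu>) k r"
proof -
  have "approx (weight N) k r = (\<integral>x. weight N x * cn (\<nu> k) r x \<partial>lborel)"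
    unfolding approx_def using sol_outside[OF \<open>0 \<le> r\<close>, of _ k]
    by (intro Bochner_Integration.integral_cong refl) (auto simp: trunc_test_def indicator_def)
  moreover have "integrable lborel (cn (\<nu> k) r)" "AE x in lborel. 0 \<le> cn (\<nu> k) r x"
    using sol[OF \<nu>(2)] truncated_solution_integrable[OF sol[OF \<nu>(2)]] \<open>0 \<le> r\<close>
    by (auto simp: truncated_solution_def)
  ultimately show ?thesis
    using growth_rate_ge[of "cn (\<nu> k) r" N "\<nu> k" l] assms
    by (simp add: rate_def trunc_test_def[abs_def])
qed

lemma power_moment_mono:
  assumes "0 \<le> s" "s \<le> t" "t < T"
  shows "functional (\<lambda>x. x powr \<mu>) s \<le> functional (\<lambda>x. x powr \<mu>) t"
proof (rule LIMSEQ_le[OF approx_tendsto approx_tendsto])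
  have "approx (\<lambda>x. x powr \<mu>) k s \<le> approx (\<lambda>x. x powr \<mu>) k t" for k
  proof -
    have "0 * (t - s) \<le> approx (\<lambda>x. x powr \<mu>) k t - approx (\<lambda>x. x powr \<mu>) k s"
      \<comment> \<open>With l = 0 the lower bound is zero, and N = 1 is admissible for every k
        since \<nu> k >= 2.\<close>
      using rate_ge[of _ 1 k 0] assms \<nu>(2)
      by (intro growth_from_derivative_bound[OF approx_deriv[OF test_function_powr]]) auto
    then show ?thesis by simp
  qed
  then show "\<exists>N. \<forall>k\<ge>N. approx (\<lambda>x. x powr \<mu>) k s \<le> approx (\<lambda>x. x powr \<mu>) k t" by blast
qed (use assms test_function_powr in auto)

lemma full_weight_functional_ge:
  assumes t: "0 \<le> t" "t < T"
  shows "moment 2 \<phi>1 * functional (\<lambda>x. x powr \<mu>) t - moment (1 + \<mu>) \<phi>1 * functional (\<lambda>x. x) 0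
    \<le> functional full_weight t"
proof -
  define f where "f = (\<lambda>x. moment 2 \<phi>1 * x powr \<mu> - moment (1 + \<mu>) \<phi>1 * x)"
  have f: "test_function f"
  proof -
    have "\<bar>f x\<bar> \<le> (\<bar>moment 2 \<phi>1\<bar> + \<bar>moment (1 + \<mu>) \<phi>1\<bar>) * (1 + x\<^sup>2)" if "0 \<le> x" for x
    proof -
      have "\<bar>f x\<bar> \<le> \<bar>moment 2 \<phi>1\<bar> * x powr \<mu> + \<bar>moment (1 + \<mu>) \<phi>1\<bar> * x"
        using that unfolding f_def by (intro order_trans[OF abs_triangle_ineq4]) (simp add: abs_mult)
      also have "\<dots> \<le> \<bar>moment 2 \<phi>1\<bar> * (1 + x\<^sup>2) + \<bar>moment (1 + \<mu>) \<phi>1\<bar> * (1 + x\<^sup>2)"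
        using that mu powr_le_one_plus_square[OF that, of 1]
        by (intro add_mono mult_left_mono powr_le_one_plus_square) auto
      finally show ?thesis by (simp add: distrib_right)
    qed
    then show ?thesis unfolding test_function_def
      by (intro conjI exI[of _ "\<bar>moment 2 \<phi>1\<bar> + \<bar>moment (1 + \<mu>) \<phi>1\<bar>"]) (auto simp: f_def)
  qed
  have "functional f t = moment 2 \<phi>1 * functional (\<lambda>x. x powr \<mu>) t - moment (1 + \<mu>) \<phi>1 * functional (\<lambda>x. x) t"
  proof -
    have "functional f t = (LBINT x:{0..}. moment 2 \<phi>1 * (x powr \<mu> * c t x) - moment (1 + \<mu>) \<phi>1 * (x * c t x))"
      unfolding functional_def f_def by (simp add: algebra_simps)
    then show ?thesis
      using functional_integrable[OF test_function_powr t] functional_integrable[OF test_function_id t]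
      by (simp add: functional_def set_integral_diff)
  qed
  then show ?thesis
    using functional_mono[OF f test_function_weights(2) t] full_weight_ge first_moment_conserved[OF t]
    by (simp add: f_def)
qed

lemma weight_functional_tendsto:
  assumes t: "0 \<le> t" "t < T"
  shows "(\<lambda>N. functional (weight (Suc N)) t) \<longlonglongrightarrow> functional full_weight t"
  unfolding functional_def set_lebesgue_integral_def
proof (rule integral_dominated_convergence)
  show "integrable lborel (\<lambda>x. moment 2 \<phi>1 * \<bar>indicator {0..} x *\<^sub>R (x powr \<mu> * c t x)\<bar>)"
    using functional_integrable[OF test_function_powr t] by (auto simp: set_integrable_def)
  show "(\<lambda>x. indicator {0..} x *\<^sub>R (full_weight x * c t x)) \<in> borel_measurable lborel"
    "(\<lambda>x. indicator {0..} x *\<^sub>R (weight (Suc N) x * c t x)) \<in> borel_measurable lborel" for N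
    using functional_integrable[OF test_function_weights(1) t] functional_integrable[OF test_function_weights(2) t]
    by (auto simp: set_integrable_def)
  show "AE x in lborel. (\<lambda>N. indicator {0..} x *\<^sub>R (weight (Suc N) x * c t x))
      \<longlonglongrightarrow> indicator {0..} x *\<^sub>R (full_weight x * c t x)"
    by (intro AE_I2 tendsto_intros weight_tendsto)
  show "AE x in lborel. norm (indicator {0..} x *\<^sub>R (weight (Suc N) x * c t x))
      \<le> moment 2 \<phi>1 * \<bar>indicator {0..} x *\<^sub>R (x powr \<mu> * c t x)\<bar>" for N
  proof (rule AE_I2)
    fix x
    have "weight (Suc N) x * \<bar>c t x\<bar> \<le> moment 2 \<phi>1 * x powr \<mu> * \<bar>c t x\<bar>"
      by (intro mult_right_mono weight_le) simp
    then show "norm (indicator {0..} x *\<^sub>R (weight (Suc N) x * c t x))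
      \<le> moment 2 \<phi>1 * \<bar>indicator {0..} x *\<^sub>R (x powr \<mu> * c t x)\<bar>"
      using weight_nonneg[of "Suc N" x] by (auto simp: indicator_def abs_mult)
  qed
qed

section \<open>Quadratic growth of the corrected moment and its blow-up\<close>

text \<open>The tangent point is l = m(s), constant in time. For a given error e, compactness in
  time fixes \<open>N\<close>, then k tends to infinity, and e tends to 0 last; the nonnegativity of
  m(s) allows multiplying the linear lower bound by 2 m(s).\<close>

lemma power_moment_step:
  assumes st: "0 \<le> s" "s \<le> t" "t < T"
    and a: "0 < moment 2 \<phi>1"
  defines "m \<equiv> \<lambda>r. functional (\<lambda>x. x powr \<mu>) r
      - moment (1 + \<mu>) \<phi>1 / moment 2 \<phi>1 * functional (\<lambda>x. x) 0"
  assumes pos: "0 \<le> m s"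
  shows "\<mu> * (\<mu> - 1) * 2 powr (\<mu> - 2) * moment 2 \<phi>1 * (t - s) * (m s)\<^sup>2 \<le> m t - m s"
proof -
  define \<kappa> where "\<kappa> = \<mu> * (\<mu> - 1) * 2 powr (\<mu> - 2)"
  define A where "A = moment 2 \<phi>1"
  have \<kappa>: "0 \<le> \<kappa>" using mu by (simp add: \<kappa>_def)
  \<comment> \<open>Monotonicity of the moment lets the value at the left end serve on the whole
    interval.\<close>
  have W: "A * m s \<le> functional full_weight r" if "s \<le> r" "r \<le> t" for r
  proof -
    have "A * m s \<le> A * m r"
      using that st a power_moment_mono[of s r] by (intro mult_left_mono) (auto simp: m_def A_def)
    also have "\<dots> = A * functional (\<lambda>x. x powr \<mu>) r - moment (1 + \<mu>) \<phi>1 * functional (\<lambda>x. x) 0"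
      using a by (simp add: m_def A_def right_diff_distrib)
    also have "\<dots> \<le> functional full_weight r"
      using that st full_weight_functional_ge[of r] by (simp add: A_def)
    finally show ?thesis .
  qed
  have step: "\<kappa> * (A * (m s)\<^sup>2 - e * (4 * m s)) * (t - s) \<le> m t - m s" if "0 < e" for e
  proof -
    have "\<exists>N. \<forall>r\<in>{s..t}. functional full_weight r - e < functional (weight (Suc N)) r"
    proof (rule dini_lower[OF _ _ _ _ \<open>0 < e\<close>])
      show "continuous_on {s..t} (functional (weight (Suc N)))" "continuous_on {s..t} (functional full_weight)" for N
        using st functional_continuous[OF test_function_weights(1), of t] functional_continuous[OF test_function_weights(2), of t]
        by (auto intro: continuous_on_subset[of "{0..t}"])
      fix r assume "r \<in> {s..t}"
      then have r: "0 \<le> r" "r < T" using st by auto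
      show "functional (weight (Suc N)) r \<le> functional (weight (Suc (Suc N))) r" for N
        by (intro functional_mono test_function_weights r weight_mono) simp
      show "(\<lambda>N. functional (weight (Suc N)) r) \<longlonglongrightarrow> functional full_weight r"
        by (rule weight_functional_tendsto[OF r])
    qed
    then obtain M where M: "\<And>r. r \<in> {s..t} \<Longrightarrow> functional full_weight r - e < functional (weight (Suc M)) r"
      by blast
    define N where "N = Suc M"
    have "\<forall>\<^sub>F k in sequentially. \<forall>r\<in>{0..t}. dist (approx (weight N) k r) (functional (weight N) r) < e"
      using st by (intro uniform_limitD[OF approx_uniform_limit[OF test_function_weights(1)]] \<open>0 < e\<close>) auto
    moreover have "\<forall>\<^sub>F k in sequentially. 2 * N \<le> \<nu> k"
      using filterlim_subseq[OF \<nu>(1)] by (simp add: filterlim_at_top)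
    ultimately have "\<forall>\<^sub>F k in sequentially. \<kappa> * (A * (m s)\<^sup>2 - e * (4 * m s)) * (t - s)
        \<le> approx (\<lambda>x. x powr \<mu>) k t - approx (\<lambda>x. x powr \<mu>) k s"
    proof eventually_elim
      case (elim k)
      show ?case
      proof (rule growth_from_derivative_bound[OF approx_deriv[OF test_function_powr] st(1,2)])
        fix r assume r: "s \<le> r" "r \<le> t"
        \<comment> \<open>One e pays for the cut at level \<open>N\<close>, the other for replacing
          the limit by the k-th truncated solution. Multiplied by 2 m(s), they form the error term e
          * (4 * m s).\<close>
        have "A * m s - 2 * e \<le> approx (weight N) k r"
        proof -
          have "\<bar>approx (weight N) k r - functional (weight N) r\<bar> < e"
            using elim(1) r st by (auto simp: dist_real_def)
          moreover have "functional full_weight r - e < functional (weight N) r"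
            using M[of r] r by (simp add: N_def)
          ultimately show ?thesis using W[OF r] by linarith
        qed
        then have "2 * m s * (A * m s - 2 * e) \<le> 2 * m s * approx (weight N) k r"
          using pos by (intro mult_left_mono) auto
        then have "A * (m s)\<^sup>2 - e * (4 * m s) \<le> 2 * m s * approx (weight N) k r - (m s)\<^sup>2 * A"
          by (simp add: power2_eq_square algebra_simps)
        then have "\<kappa> * (A * (m s)\<^sup>2 - e * (4 * m s)) \<le> \<kappa> * (2 * m s * approx (weight N) k r - (m s)\<^sup>2 * A)"
          using \<kappa> by (rule mult_left_mono)
        also have "\<dots> \<le> rate (\<lambda>x. x powr \<mu>) k r"
          using rate_ge[of r N k "m s"] r st elim(2) by (simp add: \<kappa>_def A_def N_def)
        finally show "\<kappa> * (A * (m s)\<^sup>2 - e * (4 * m s)) \<le> rate (\<lambda>x. x powr \<mu>) k r" .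
      qed
    qed
    then have "\<kappa> * (A * (m s)\<^sup>2 - e * (4 * m s)) * (t - s)
        \<le> functional (\<lambda>x. x powr \<mu>) t - functional (\<lambda>x. x powr \<mu>) s"
      using st by (intro tendsto_lowerbound[OF tendsto_diff[OF approx_tendsto approx_tendsto]] test_function_powr) auto
    then show ?thesis by (simp add: m_def)
  qed
  have "(\<lambda>j. \<kappa> * (A * (m s)\<^sup>2 - inverse (real (Suc j)) * (4 * m s)) * (t - s))
      \<longlonglongrightarrow> \<kappa> * (A * (m s)\<^sup>2 - 0 * (4 * m s)) * (t - s)"
    by (intro tendsto_intros LIMSEQ_inverse_real_of_nat)
  then have "\<kappa> * (A * (m s)\<^sup>2 - 0 * (4 * m s)) * (t - s) \<le> m t - m s"
    by (rule LIMSEQ_le_const2) (auto intro!: step)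
  then show ?thesis by (simp add: \<kappa>_def A_def mult_ac)
qed

lemma power_moment_blowup:
  assumes t: "0 \<le> t" "t < T" and a: "0 < moment 2 \<phi>1"
  defines "m \<equiv> \<lambda>r. functional (\<lambda>x. x powr \<mu>) r
      - moment (1 + \<mu>) \<phi>1 / moment 2 \<phi>1 * functional (\<lambda>x. x) 0"
  assumes m0: "0 < m 0"
  shows "0 < m t"
    and "\<mu> * (\<mu> - 1) * 2 powr (\<mu> - 2) * moment 2 \<phi>1 * t \<le> inverse (m 0) - inverse (m t)"
proof -
  have pos: "0 < m s" if "0 \<le> s" "s \<le> t" for s
    using power_moment_mono[of 0 s] that t m0 by (simp add: m_def)
  then show "0 < m t" using t by simp
  show "\<mu> * (\<mu> - 1) * 2 powr (\<mu> - 2) * moment 2 \<phi>1 * t \<le> inverse (m 0) - inverse (m t)"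
  proof (rule discrete_riccati)
    show "\<mu> * (\<mu> - 1) * 2 powr (\<mu> - 2) * moment 2 \<phi>1 * (s - r) * (m r)\<^sup>2 \<le> m s - m r"
      if "0 \<le> r" "r \<le> s" "s \<le> t" for r s
      using power_moment_step[of r s] that t a pos[of r] unfolding m_def by simp
  qed (use pos t a mu in auto)
qed

lemma functional_moments:
  assumes "0 \<le> t" "t < T"
  shows "functional (\<lambda>x. x powr \<mu>) t = moment \<mu> (c t)" "functional (\<lambda>x. x) t = moment 1 (c t)"
  unfolding functional_def moment_def set_lebesgue_integral_def
  by (auto intro!: Bochner_Integration.integral_cong simp: indicator_def)

end

section \<open>Conclusion for the constructed solution\<close>

lemma moment_nonneg:
  assumes "AE x\<in>{0..} in lborel. 0 \<le> c x"
  shows "0 \<le> moment r c"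
  unfolding moment_def set_lebesgue_integral_def
  using assms by (intro integral_nonneg_AE) (auto elim!: eventually_mono simp: indicator_def)

lemma moment_cong_AE:
  assumes c: "c \<in> Y \<beta> s" and d: "d \<in> Y \<beta>' s'" and ae: "AE x\<in>{0..} in lborel. c x = d x"
  shows "moment r c = moment r d"
  unfolding moment_def set_lebesgue_integral_def
proof (rule integral_cong_AE)
  have "(\<lambda>x. x powr r * (indicator {0..} x *\<^sub>R c x)) \<in> borel_measurable lborel"
    "(\<lambda>x. x powr r * (indicator {0..} x *\<^sub>R d x)) \<in> borel_measurable lborel"
  proof -
    have "(\<lambda>x. indicator {0..} x *\<^sub>R c x) \<in> borel_measurable lborel"
      "(\<lambda>x. indicator {0..} x *\<^sub>R d x) \<in> borel_measurable lborel"
      using c d unfolding Y_def set_integrable_def by blast+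
    then show "(\<lambda>x. x powr r * (indicator {0..} x *\<^sub>R c x)) \<in> borel_measurable lborel"
      "(\<lambda>x. x powr r * (indicator {0..} x *\<^sub>R d x)) \<in> borel_measurable lborel"
      by measurable
  qed
  then show "(\<lambda>x. indicator {0..} x *\<^sub>R (x powr r * c x)) \<in> borel_measurable lborel"
    "(\<lambda>x. indicator {0..} x *\<^sub>R (x powr r * d x)) \<in> borel_measurable lborel"
    by (simp_all add: mult_ac)
  show "AE x in lborel. indicator {0..} x *\<^sub>R (x powr r * c x) = indicator {0..} x *\<^sub>R (x powr r * d x)"
    using ae by eventually_elim (auto simp: indicator_def)
qed

theorem theorem1p15:
  fixes K DK D2K :: kernel
    and \<phi> \<phi>1 c0 :: "real \<Rightarrow> real"
    and \<mu> T0 :: real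
    and c :: "real \<Rightarrow> real \<Rightarrow> real"
  assumes K_meas: "set_borel_measurable borel octant (\<lambda>(x, y, z). K x y z)"
    and K_nonneg: "\<And>x y z. x \<ge> 0 \<Longrightarrow> y \<ge> 0 \<Longrightarrow> z \<ge> 0 \<Longrightarrow> 0 \<le> K x y z"
    and K_sym: "\<And>x y z. x \<ge> 0 \<Longrightarrow> y \<ge> 0 \<Longrightarrow> z \<ge> 0 \<Longrightarrow> K x y z = K y x z"
    and K_zero: "\<And>x y z. x \<ge> 0 \<Longrightarrow> y \<ge> 0 \<Longrightarrow> z \<ge> 0 \<Longrightarrow> z > x \<Longrightarrow> K x y z = 0"
    and mu: "1 < \<mu>" "\<mu> \<le> 2"
    and phi: "\<phi> \<in> Y_pos 0 2"
    and phi1: "\<phi>1 \<in> Y_pos 0 (1 + \<mu>)"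
    and K_lower: "\<And>x y z. x \<ge> 0 \<Longrightarrow> y \<ge> 0 \<Longrightarrow> z \<ge> 0 \<Longrightarrow>
        \<phi>1 z * ((max 1 x)\<^sup>2 * max 1 y powr \<mu> + max 1 x powr \<mu> * (max 1 y)\<^sup>2)
          * indicator ({z<..} \<times> {z<..}) (x, y) \<le> K x y z"
    and K_upper: "\<And>x y z. x \<ge> 0 \<Longrightarrow> y \<ge> 0 \<Longrightarrow> z \<ge> 0 \<Longrightarrow>
        K x y z \<le> (max 1 x)\<^sup>2 * (max 1 y)\<^sup>2 * \<phi> z"
    \<comment> \<open>The point \<open>x = z\<close> is excluded: by \<open>K_zero\<close> and \<open>K_lower\<close>, \<open>K\<close> jumps there if \<open>\<phi>1 z > 0\<close>.\<close>
    and K_deriv: "\<And>x y z. x \<ge> 0 \<Longrightarrow> y \<ge> 0 \<Longrightarrow> z \<ge> 0 \<Longrightarrow> x \<noteq> z \<Longrightarrow>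
        ((\<lambda>u. K u y z) has_real_derivative DK x y z) (at x within {0..})"
    and K_deriv2: "\<And>x y z. x \<ge> 0 \<Longrightarrow> y \<ge> 0 \<Longrightarrow> z \<ge> 0 \<Longrightarrow> x \<noteq> z \<Longrightarrow>
        ((\<lambda>u. DK u y z) has_real_derivative D2K x y z) (at x within {0..})"
    and K_deriv2_le: "\<And>x y z. x \<ge> 0 \<Longrightarrow> y \<ge> 0 \<Longrightarrow> z \<ge> 0 \<Longrightarrow> x \<noteq> z \<Longrightarrow>
        D2K x y z \<le> (max 1 y)\<^sup>2 * \<phi> z"
    and c0: "c0 \<in> Y_pos 0 (1 + \<mu>)"
    and c0_nontrivial: "\<not> (AE x\<in>{0..} in lborel. c0 x = 0)"
    and moments: "moment 2 \<phi>1 * moment \<mu> c0 > moment (1 + \<mu>) \<phi>1 * moment 1 c0"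
    and T0: "T0 = inverse (2 * Y_norm 0 2 \<phi> * (moment 0 c0 + moment 2 c0))"
    and c: "constructed_solution K c0 T0 c"
  shows "(\<forall>t\<in>{0..<T0}.
            moment \<mu> (c t) \<ge>
              inverse (inverse (moment \<mu> c0 - moment (1 + \<mu>) \<phi>1 / moment 2 \<phi>1 * moment 1 c0)
                       - \<mu> * (\<mu> - 1) * 2 powr (\<mu> - 2) * moment 2 \<phi>1 * t)
              + moment (1 + \<mu>) \<phi>1 / moment 2 \<phi>1 * moment 1 c0)
       \<and> gelation_time T0 c < \<infinity>
       \<and> gelation_time T0 c \<le>
            ereal (inverse (\<mu> * (\<mu> - 1) * 2 powr (\<mu> - 2) * moment 2 \<phi>1
              * (moment \<mu> c0 - moment (1 + \<mu>) \<phi>1 / moment 2 \<phi>1 * moment 1 c0)))"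
proof -
  obtain cn \<nu> where sol: "\<forall>n\<ge>2. truncated_solution K c0 n (cn n)"
    and \<nu>: "strict_mono \<nu>" "\<forall>k. 2 \<le> \<nu> k"
    and conv: "\<forall>S\<in>{0..<T0}. \<forall>g\<in>L_infty. uniform_limit {0..S}
      (\<lambda>k t. LBINT x:{0..}. g x * (1 + x\<^sup>2) * cn (\<nu> k) t x)
      (\<lambda>t. LBINT x:{0..}. g x * (1 + x\<^sup>2) * c t x) sequentially"
    using c unfolding constructed_solution_def by blast
  have c_Y: "c t \<in> Y_pos 0 2" if "0 \<le> t" "t < T0" for t
    using c that by (simp add: constructed_solution_def weak_solution_def)
  interpret gelling_solution K \<phi> \<phi>1 \<mu> c0 T0 c cn \<nu>
  proof unfold_locales
    show "set_integrable lborel {0..} \<phi>" using phi by (simp add: Y_pos_def Y_def)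
    show "uniform_limit {0..S} (\<lambda>k t. LBINT x:{0..}. g x * (1 + x\<^sup>2) * cn (\<nu> k) t x)
        (\<lambda>t. LBINT x:{0..}. g x * (1 + x\<^sup>2) * c t x) sequentially"
      if "0 \<le> S" "S < T0" "g \<in> L_infty" for S g
      using conv that by auto
  qed (fact K_meas | rule K_nonneg K_sym K_upper mu phi1 K_lower c_Y sol[rule_format] \<nu>(1) \<nu>(2)[rule_format]; assumption)+
  define A where "A = moment 2 \<phi>1"
  define B where "B = moment (1 + \<mu>) \<phi>1 / A * moment 1 c0"
  define \<kappa> where "\<kappa> = \<mu> * (\<mu> - 1) * 2 powr (\<mu> - 2) * A"
  have "0 \<le> moment (1 + \<mu>) \<phi>1 * moment 1 c0"
    using phi1 c0 by (intro mult_nonneg_nonneg moment_nonneg) (auto simp: Y_pos_def)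
  \<comment> \<open>If M_2(phi1) were 0, the moment assumption would make a nonnegative product
    negative. The divisions by M_2(phi1) are therefore genuine.\<close>
  then have A: "0 < A"
    using moments moment_2_nonneg by (cases "A = 0") (auto simp: A_def)
  then have \<kappa>: "0 < \<kappa>" using mu by (simp add: \<kappa>_def)
  have m0: "0 < moment \<mu> c0 - B"
    using moments A by (simp add: A_def B_def field_simps)
  have bounds: "0 < moment \<mu> (c t) - B"
    "\<kappa> * t \<le> inverse (moment \<mu> c0 - B) - inverse (moment \<mu> (c t) - B)"
    if t: "0 \<le> t" "t < T0" for t
  proof -
    have "0 < T0" using t by simp
    \<comment> \<open>The representatives \<open>c 0\<close> and \<open>c0\<close> agree only almost
      everywhere.\<close>
    moreover have "moment r (c 0) = moment r c0" for r
      using c c_Y[of 0] c0 \<open>0 < T0\<close>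
      by (intro moment_cong_AE[of _ 0 2 _ 0 "1 + \<mu>"]) (auto simp: Y_pos_def constructed_solution_def)
    ultimately have "functional (\<lambda>x. x powr \<mu>) 0 = moment \<mu> c0" "functional (\<lambda>x. x) 0 = moment 1 c0"
      by (simp_all add: functional_moments)
    then show "0 < moment \<mu> (c t) - B"
      "\<kappa> * t \<le> inverse (moment \<mu> c0 - B) - inverse (moment \<mu> (c t) - B)"
      using power_moment_blowup[OF t] A m0 functional_moments[OF t]
      by (simp_all add: A_def B_def \<kappa>_def)
  qed
  have "inverse (inverse (moment \<mu> c0 - B) - \<kappa> * t) + B \<le> moment \<mu> (c t)" if "t \<in> {0..<T0}" for t
  proof -
    have t: "0 \<le> t" "t < T0" using that by auto
    \<comment> \<open>The denominator on the left is at least 1 / m(t) > 0, so inversion reverses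
      the order and no inverse of zero occurs.\<close>
    have "inverse (inverse (moment \<mu> c0 - B) - \<kappa> * t) \<le> inverse (inverse (moment \<mu> (c t) - B))"
      using bounds[OF t] by (intro le_imp_inverse_le) auto
    then show ?thesis by simp
  qed
  moreover have gel: "gelation_time T0 c \<le> ereal (inverse (\<kappa> * (moment \<mu> c0 - B)))"
    unfolding gelation_time_def
  proof (intro SUP_least)
    fix t assume "t \<in> {t \<in> {0..<T0}. (\<integral>\<^sup>+x\<in>{0..}. ennreal (x powr 2 * c t x) \<partial>lborel) < \<infinity>}"
    then have t: "0 \<le> t" "t < T0" by auto
    \<comment> \<open>Dropping the positive term 1 / m(t) bounds every time of existence, hence the
      supremum.\<close>
    have "\<kappa> * t \<le> inverse (moment \<mu> c0 - B)"
      using bounds[OF t] by (smt (verit) positive_imp_inverse_positive)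
    then have "t \<le> inverse (\<kappa> * (moment \<mu> c0 - B))"
      using \<kappa> by (simp add: inverse_mult_distrib inverse_eq_divide[of \<kappa>] pos_le_divide_eq mult.commute)
    then show "ereal t \<le> ereal (inverse (\<kappa> * (moment \<mu> c0 - B)))" by simp
  qed
  moreover have "gelation_time T0 c < \<infinity>"
    using gel by (rule le_less_trans) simp
  ultimately show ?thesis unfolding A_def B_def \<kappa>_def by blast
qed

end
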